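(* For each $n\ge1$ let $X^{(n)}(\cdot)=(X^{(n)}_i(\cdot))_{i=1}^\infty$ be a stochastic fragmentation process with values in $\mathbb S^{\downarrow}$, and define $$Q^{(n)}(t):=\sum_{i=1}^\infty \bigl(X_i^{(n)}(t)\bigr)^2,\qquad t\ge 0.$$ Assume that $Q^{(n)}(0)<\infty$ for every $n$ (which implies $Q^{(n)}(t)<\infty$ for every $t\ge0$). Suppose further that (i) for every fixed $t\ge0$, the family $(X^{(n)}(t))_{n\ge1}$ of random variables in $\mathbb S^{\downarrow}$ is tight, and (ii) for every uniformly bounded sequence $(\tau_n)$ where each $\tau_n$ is an $X^{(n)}$-stopping time, and every sequence $(h_n)$ of positive numbers with $h_n\to0$, we have, as $n\to\infty$, $$Q^{(n)}(\tau_n)-Q^{(n)}(\tau_n+h_n)\to 0\quad\text{in probability}.$$ Then the family of processes $X^{(n)}(\cdot)$, $n\ge1$, is tight in $D(\mathbb R_+,\mathbb S^{\downarrow})$.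
   Context: $\mathbb R_+:=[0,\infty)$, $\mathbb N:=\{1,2,3,\dots\}$. $\mathbb S^{\downarrow}:=\{(x_i)_{i=1}^\infty: x_i\in\mathbb R,\ x_1\ge x_2\ge\dots\ge0\}$, equipped with the product topology (as a subspace of $\mathbb R^\infty$), generated e.g. by the complete separable metric $d((x_i),(y_i))=\sum_{i\ge1}2^{-i}\min(|x_i-y_i|,1)$. Partial order on $\mathbb S^{\downarrow}$: $(y_i)_{1}^\infty\preceq(x_i)_{1}^\infty$ iff there exists $\alpha:\mathbb N\to\mathbb N$ such that $\sum_{j:\alpha(j)=i}y_j\le x_i$ for all $i\in\mathbb N$. A fragmentation process is a (deterministic or random) function $X(\cdot)=(X_i(\cdot))_{i=1}^\infty:\mathbb R_+\to\mathbb S^{\downarrow}$ that is càdlàg for the product topology and satisfies $X(t_2)\preceq X(t_1)$ whenever $0\le t_1\le t_2$. No other property (e.g. Markov) is assumed. An $X$-stopping time is a random time that is a stopping time for the natural filtration $\mathcal F_t=\sigma\{X(s):s\le t\}$, $t\ge0$. $D(\mathbb R_+,\mathbb S^{\downarrow})$ is the space of càdlàg functions $\mathbb R_+\to\mathbb S^{\downarrow}$ with the Skorohod $J_1$ topology. *)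

theory Defs
  imports "HOL-Probability.Probability"
begin

subsection \<open>Decreasing sequences and their fragmentation order\<close>

text \<open>Sequences are indexed from \<open>0\<close> instead of \<open>1\<close>.  The type \<open>nat \<Rightarrow> real\<close> carries the product
  topology, generated by the library metric with the weights \<open>(1/2)^i\<close>.\<close>

definition S_down :: "(nat \<Rightarrow> real) set" where
  "S_down = {x. decseq x \<and> (\<forall>i. 0 \<le> x i)}"

text \<open>The sums below may have infinitely many terms, and may diverge; they are taken in
  \<open>[0,\<infinity>]\<close> to avoid the default value \<open>0\<close> of a divergent real sum.\<close>

definition frag_le :: "(nat \<Rightarrow> real) \<Rightarrow> (nat \<Rightarrow> real) \<Rightarrow> bool" (infix "\<preceq>" 50) where
  "y \<preceq> x \<longleftrightarrow>
     (\<exists>\<alpha> :: nat \<Rightarrow> nat. \<forall>i. (\<Sum>\<^sub>\<infinity>j\<in>{j. \<alpha> j = i}. ennreal (y j)) \<le> ennreal (x i))"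

definition Q :: "(nat \<Rightarrow> real) \<Rightarrow> ennreal" where
  "Q x = (\<Sum>i. ennreal ((x i)\<^sup>2))"

subsection \<open>The Skorohod space of cadlag functions on the half-line\<close>

definition cadlag :: "'b::topological_space set \<Rightarrow> (real \<Rightarrow> 'b) \<Rightarrow> bool" where
  "cadlag S x \<longleftrightarrow>
     (\<forall>t\<ge>0. x t \<in> S \<and> (x \<longlongrightarrow> x t) (at_right t)) \<and>
     (\<forall>t>0. \<exists>l\<in>S. (x \<longlongrightarrow> l) (at_left t))"

text \<open>Functions on \<open>[0,\<infinity>)\<close> are represented by functions on the reals that are \<open>undefined\<close> on the
  negative half-line.\<close>

definition skorohod_space :: "'b::topological_space set \<Rightarrow> (real \<Rightarrow> 'b) set" where
  "skorohod_space S = {x \<in> extensional {0..}. cadlag S x}"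

definition time_change :: "(real \<Rightarrow> real) \<Rightarrow> bool" where
  "time_change \<theta> \<longleftrightarrow> strict_mono_on {0..} \<theta> \<and> bij_betw \<theta> {0..} {0..}"

definition skorohod_nbhd ::
    "'b::metric_space set \<Rightarrow> (real \<Rightarrow> 'b) \<Rightarrow> real \<Rightarrow> real \<Rightarrow> (real \<Rightarrow> 'b) set" where
  "skorohod_nbhd S x T \<epsilon> =
     {y \<in> skorohod_space S. \<exists>\<theta>. time_change \<theta> \<and>
        (\<forall>t\<in>{0..T}. \<bar>\<theta> t - t\<bar> < \<epsilon> \<and> dist (y t) (x (\<theta> t)) < \<epsilon>)}"

text \<open>The \<open>J1\<close> topology: the sets \<open>skorohod_nbhd S x T \<epsilon>\<close> are a base of neighbourhoods of \<open>x\<close>.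
  Equivalently, \<open>x\<^sub>n\<close> converges to \<open>x\<close> iff for each \<open>T\<close> there are time changes \<open>\<theta>\<^sub>n\<close> such
  that \<open>\<theta>\<^sub>n t - t\<close> and \<open>dist (x\<^sub>n t) (x (\<theta>\<^sub>n t))\<close> tend to \<open>0\<close> uniformly for \<open>t\<close> in \<open>[0,T]\<close>
  (Ethier and Kurtz, Markov Processes, Proposition 3.5.3).\<close>

definition skorohod_J1 :: "'b::metric_space set \<Rightarrow> (real \<Rightarrow> 'b) topology" where
  "skorohod_J1 S = topology (\<lambda>U. U \<subseteq> skorohod_space S \<and>
     (\<forall>x\<in>U. \<exists>T>0. \<exists>\<epsilon>>0. skorohod_nbhd S x T \<epsilon> \<subseteq> U))"

lemma skorohod_nbhd_mono:
  assumes "T \<le> T'" "\<epsilon>' \<le> \<epsilon>"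
  shows "skorohod_nbhd S x T' \<epsilon>' \<subseteq> skorohod_nbhd S x T \<epsilon>"
proof
  fix y assume "y \<in> skorohod_nbhd S x T' \<epsilon>'"
  then obtain \<theta> where y: "y \<in> skorohod_space S" and \<theta>: "time_change \<theta>"
    and *: "\<And>t. t \<in> {0..T'} \<Longrightarrow> \<bar>\<theta> t - t\<bar> < \<epsilon>' \<and> dist (y t) (x (\<theta> t)) < \<epsilon>'"
    unfolding skorohod_nbhd_def by blast
  have "\<bar>\<theta> t - t\<bar> < \<epsilon> \<and> dist (y t) (x (\<theta> t)) < \<epsilon>" if "t \<in> {0..T}" for t
    using *[of t] that assms by auto
  with y \<theta> show "y \<in> skorohod_nbhd S x T \<epsilon>"
    unfolding skorohod_nbhd_def by blast
qed

lemma openin_skorohod_J1: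
  "openin (skorohod_J1 S) U \<longleftrightarrow>
     U \<subseteq> skorohod_space S \<and> (\<forall>x\<in>U. \<exists>T>0. \<exists>\<epsilon>>0. skorohod_nbhd S x T \<epsilon> \<subseteq> U)"
proof -
  let ?L = "\<lambda>U. U \<subseteq> skorohod_space S \<and> (\<forall>x\<in>U. \<exists>T>0. \<exists>\<epsilon>>0. skorohod_nbhd S x T \<epsilon> \<subseteq> U)"
  have "istopology ?L"
    unfolding istopology_def
  proof (intro conjI allI impI)
    fix U V assume U: "?L U" and V: "?L V"
    show "U \<inter> V \<subseteq> skorohod_space S" using U by blast
    show "\<forall>x\<in>U \<inter> V. \<exists>T>0. \<exists>\<epsilon>>0. skorohod_nbhd S x T \<epsilon> \<subseteq> U \<inter> V"
    proof
      fix x assume x: "x \<in> U \<inter> V"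
      obtain T1 e1 where 1: "T1 > 0" "e1 > 0" "skorohod_nbhd S x T1 e1 \<subseteq> U"
        using U x by blast
      obtain T2 e2 where 2: "T2 > 0" "e2 > 0" "skorohod_nbhd S x T2 e2 \<subseteq> V"
        using V x by blast
      have "skorohod_nbhd S x (max T1 T2) (min e1 e2) \<subseteq> U \<inter> V"
        using 1(3) 2(3) skorohod_nbhd_mono[of T1 "max T1 T2" "min e1 e2" e1 S x]
          skorohod_nbhd_mono[of T2 "max T1 T2" "min e1 e2" e2 S x] by auto
      moreover have "max T1 T2 > 0" "min e1 e2 > 0" using 1 2 by auto
      ultimately show "\<exists>T>0. \<exists>\<epsilon>>0. skorohod_nbhd S x T \<epsilon> \<subseteq> U \<inter> V" by blast
    qed
  next
    fix \<K> assume K: "\<forall>U\<in>\<K>. ?L U"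
    show "\<Union>\<K> \<subseteq> skorohod_space S" using K by blast
    show "\<forall>x\<in>\<Union>\<K>. \<exists>T>0. \<exists>\<epsilon>>0. skorohod_nbhd S x T \<epsilon> \<subseteq> \<Union>\<K>"
    proof
      fix x assume "x \<in> \<Union>\<K>"
      then obtain U where U: "U \<in> \<K>" "x \<in> U" by blast
      with K obtain T \<epsilon> where "T > 0" "\<epsilon> > 0" "skorohod_nbhd S x T \<epsilon> \<subseteq> U" by meson
      with U show "\<exists>T>0. \<exists>\<epsilon>>0. skorohod_nbhd S x T \<epsilon> \<subseteq> \<Union>\<K>" by blast
    qed
  qed
  then show ?thesis by (simp add: skorohod_J1_def)
qed

lemma topspace_skorohod_J1: "topspace (skorohod_J1 S) = skorohod_space S"
proof
  show "topspace (skorohod_J1 S) \<subseteq> skorohod_space S"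
    using openin_topspace[of "skorohod_J1 S"] by (simp only: openin_skorohod_J1)
  have "openin (skorohod_J1 S) (skorohod_space S)"
    unfolding openin_skorohod_J1 by (auto simp: skorohod_nbhd_def intro!: exI[of _ 1])
  then show "skorohod_space S \<subseteq> topspace (skorohod_J1 S)" by (rule openin_subset)
qed

subsection \<open>Stochastic notions\<close>

definition fragmentation_path :: "(real \<Rightarrow> nat \<Rightarrow> real) \<Rightarrow> bool" where
  "fragmentation_path x \<longleftrightarrow>
     cadlag S_down x \<and> (\<forall>s t. 0 \<le> s \<and> s \<le> t \<longrightarrow> x t \<preceq> x s)"

text \<open>Only times \<open>t \<ge> 0\<close> matter; the values of \<open>X t\<close> for negative \<open>t\<close> are irrelevant.\<close>

definition fragmentation_process :: "'a measure \<Rightarrow> (real \<Rightarrow> 'a \<Rightarrow> nat \<Rightarrow> real) \<Rightarrow> bool" where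
  "fragmentation_process M X \<longleftrightarrow>
     (\<forall>t\<ge>0. X t \<in> borel_measurable M) \<and>
     (\<forall>\<omega>\<in>space M. fragmentation_path (\<lambda>t. X t \<omega>))"

definition sample_path :: "(real \<Rightarrow> 'a \<Rightarrow> 'b) \<Rightarrow> 'a \<Rightarrow> real \<Rightarrow> 'b" where
  "sample_path X \<omega> = (\<lambda>t\<in>{0..}. X t \<omega>)"

definition natural_filtration ::
    "'a measure \<Rightarrow> (real \<Rightarrow> 'a \<Rightarrow> 'b::topological_space) \<Rightarrow> real \<Rightarrow> 'a measure" where
  "natural_filtration M X t =
     sigma (space M) {X s -` A \<inter> space M | s A. 0 \<le> s \<and> s \<le> t \<and> A \<in> sets borel}"

text \<open>Finite stopping times only.  For \<open>t < 0\<close> the condition in \<^const>\<open>stopping_time\<close> is void,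
  because \<open>\<tau> \<ge> 0\<close>.\<close>

definition process_stopping_time ::
    "'a measure \<Rightarrow> (real \<Rightarrow> 'a \<Rightarrow> 'b::topological_space) \<Rightarrow> ('a \<Rightarrow> real) \<Rightarrow> bool" where
  "process_stopping_time M X \<tau> \<longleftrightarrow>
     (\<forall>\<omega>\<in>space M. 0 \<le> \<tau> \<omega>) \<and> stopping_time (natural_filtration M X) \<tau>"

text \<open>In the next two definitions the \<open>n\<close>-th random element lives on its own space \<open>M n\<close>.\<close>

definition tight_family :: "'b topology \<Rightarrow> (nat \<Rightarrow> 'a measure) \<Rightarrow> (nat \<Rightarrow> 'a \<Rightarrow> 'b) \<Rightarrow> bool" where
  "tight_family \<T> M Y \<longleftrightarrow>
     (\<forall>\<epsilon>>0. \<exists>K. compactin \<T> K \<and>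
        (\<forall>n. {\<omega> \<in> space (M n). Y n \<omega> \<in> K} \<in> sets (M n) \<and>
             measure (M n) {\<omega> \<in> space (M n). Y n \<omega> \<in> K} \<ge> 1 - \<epsilon>))"

definition tendsto_0_in_probability :: "(nat \<Rightarrow> 'a measure) \<Rightarrow> (nat \<Rightarrow> 'a \<Rightarrow> real) \<Rightarrow> bool" where
  "tendsto_0_in_probability M Y \<longleftrightarrow>
     (\<forall>\<epsilon>>0. (\<lambda>n. measure (M n) {\<omega> \<in> space (M n). \<bar>Y n \<omega>\<bar> > \<epsilon>}) \<longlonglongrightarrow> 0)"

end

theory Submission
  imports Defs
begin

text \<open>
  The functional \<^term>\<open>Q\<close> decreases along a fragmentation path, and it records every visible change:
  if \<open>y \<preceq> x\<close>, then no coordinate of the two sequences differs by more than \<open>sqrt (Q x - Q y)\<close>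
  (\<open>parentage_coordinate_close\<close>).  Indeed, if all pieces of a fragment of size \<open>a\<close> have size at most
  \<open>m\<close>, its breaking lowers \<open>Q\<close> by at least \<open>a (a - m) \<ge> (a - m)\<^sup>2\<close>; so a small drop of \<open>Q\<close> means that
  each large fragment has lost little, has one large heir, and keeps its rank up to a small error.
  Hence the oscillation of the path over a time interval is bounded through the drop of the real
  decreasing process \<open>t \<mapsto> Q (X t)\<close>.

  For such a process one argues as in Aldous's tightness criterion.  Cut the time axis at the
  successive times \<open>\<sigma>\<^sub>k\<close> at which \<open>Q\<close> has lost another \<open>\<epsilon>\<close>.  They are stopping times, and
  \<open>\<sigma>\<^bsub>k+1\<^esub> - \<sigma>\<^sub>k \<le> \<delta>\<close> forces \<open>Q\<close> to drop by \<open>\<epsilon>\<close> on \<open>[\<sigma>\<^sub>k, \<sigma>\<^sub>k + \<delta>]\<close>: by monotonicity the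
  increment over a deterministic delay controls a random gap.  By hypothesis (ii) such gaps are
  unlikely for small \<open>\<delta>\<close>, uniformly in \<open>k\<close> and in large \<open>n\<close>.  Since the gaps before \<open>T\<close> sum to
  at most \<open>T\<close>, there are only boundedly many of them with high probability, and so with high
  probability none is short (\<open>short_gaps_uniformly_rare\<close>).

  Consequently, with high probability and for every \<open>j\<close>, the path is constant up to \<open>1 / (j + 1)\<close> on
  the intervals of a partition of \<open>[0, j)\<close> with gaps at least \<open>\<delta>\<^sub>j\<close>.  The largest fragment shrinks
  in time, so tightness at time \<open>0\<close> confines whole paths to a compact set of sequences.  Paths
  with these two properties form a compact set for the \<open>J1\<close> topology
  (\<open>compactin_skorohod_J1_nearly_step\<close>): limits of the partitions and of the values at rational
  times determine a cadlag limit path, and moving partition points onto their limits by a piecewise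
  linear time change gives the convergence.  Finally, membership in this compact set is an event,
  because the existence of a good partition can be tested on finite sets of rational times
  (\<open>nearly_step_iff_rational\<close>).
\<close>

section \<open>Fragmentation and the loss of squared mass\<close>

lemma S_down_nonneg: "x \<in> S_down \<Longrightarrow> 0 \<le> x i"
  by (simp add: S_down_def)

lemma S_down_antimono: "x \<in> S_down \<Longrightarrow> i \<le> j \<Longrightarrow> x j \<le> x i"
  by (simp add: S_down_def decseq_def)

lemma Q_eq_suminf:
  assumes "Q x < \<infinity>"
  shows "summable (\<lambda>i. (x i)\<^sup>2)" "Q x = ennreal (\<Sum>i. (x i)\<^sup>2)"
proof -
  show s: "summable (\<lambda>i. (x i)\<^sup>2)"
    using assms by (auto intro!: summable_suminf_not_top simp: Q_def)
  show "Q x = ennreal (\<Sum>i. (x i)\<^sup>2)"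
    unfolding Q_def by (intro suminf_ennreal2 s) auto
qed

text \<open>The parent map of \<^term>\<open>y \<preceq> x\<close>, with the infinite sums over the children of one parent replaced by
  their finite subsums, so that all arithmetic stays in the reals.\<close>

definition parentage :: "(nat \<Rightarrow> real) \<Rightarrow> (nat \<Rightarrow> real) \<Rightarrow> (nat \<Rightarrow> nat) \<Rightarrow> bool" where
  "parentage y x \<alpha> \<longleftrightarrow> (\<forall>i J. finite J \<longrightarrow> (\<forall>j\<in>J. \<alpha> j = i) \<longrightarrow> sum y J \<le> x i)"

lemma frag_le_parentage:
  assumes "y \<preceq> x" "x \<in> S_down" "y \<in> S_down"
  obtains \<alpha> where "parentage y x \<alpha>"
proof -
  obtain \<alpha> where a: "\<And>i. (\<Sum>\<^sub>\<infinity>j\<in>{j. \<alpha> j = i}. ennreal (y j)) \<le> ennreal (x i)"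
    using assms(1) unfolding frag_le_def by blast
  have "sum y J \<le> x i" if "finite J" "\<forall>j\<in>J. \<alpha> j = i" for i J
  proof -
    have "ennreal (sum y J) = (\<Sum>j\<in>J. ennreal (y j))"
      by (rule sum_ennreal[symmetric]) (simp add: S_down_nonneg assms)
    also have "\<dots> \<le> (\<Sum>\<^sub>\<infinity>j\<in>{j. \<alpha> j = i}. ennreal (y j))"
      using that by (subst nonneg_infsum_complete) (auto intro!: SUP_upper)
    also have "\<dots> \<le> ennreal (x i)" by (rule a)
    finally show ?thesis
      using S_down_nonneg[OF assms(2)] by (simp add: ennreal_le_iff)
  qed
  then show ?thesis by (intro that[of \<alpha>]) (simp add: parentage_def)
qed

lemma parentage_child:
  assumes "parentage y x \<alpha>"
  shows "y j \<le> x (\<alpha> j)"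
proof -
  have "sum y {j} \<le> x (\<alpha> j)"
    using assms unfolding parentage_def by blast
  then show ?thesis by simp
qed

lemma parentage_siblings:
  assumes "parentage y x \<alpha>" "j \<noteq> k" "\<alpha> j = \<alpha> k"
  shows "y j + y k \<le> x (\<alpha> k)"
proof -
  have "\<forall>i\<in>{j, k}. \<alpha> i = \<alpha> k" using assms(3) by simp
  then have "sum y {j, k} \<le> x (\<alpha> k)"
    using assms(1) unfolding parentage_def by (metis finite.emptyI finite_insert)
  then show ?thesis using assms(2) by simp
qed

text \<open>Within a family whose members are at most \<open>b\<close>, one has \<open>\<Sum> y\<^sub>j\<^sup>2 \<le> b \<Sum> y\<^sub>j\<close>, which is at most
  \<open>b\<close> times the parent.  The bound \<open>b = m\<close> is used for the family of \<open>i\<close>, and the size of the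
  parent for all others.\<close>

lemma sum_squares_children_le:
  assumes p: "parentage y x \<alpha>" and x: "x \<in> S_down" and y: "y \<in> S_down"
    and sm: "summable (\<lambda>i. (x i)\<^sup>2)" and m: "\<And>j. \<alpha> j = i \<Longrightarrow> y j \<le> m" "0 \<le> m"
    and J: "finite J"
  shows "(\<Sum>j\<in>J. (y j)\<^sup>2) \<le> (\<Sum>k. (x k)\<^sup>2) - (x i)\<^sup>2 + m * x i"
proof -
  \<comment> \<open>\<open>c k\<close> bounds the contribution of the family of \<open>k\<close>.\<close>
  define c where "c k = (x k)\<^sup>2 + (if k = i then m * x i - (x i)\<^sup>2 else 0)" for k
  have c_nonneg: "0 \<le> c k" for k
    using m S_down_nonneg[OF x] by (auto simp: c_def)
  have family: "(\<Sum>j\<in>{j\<in>J. \<alpha> j = k}. (y j)\<^sup>2) \<le> c k" for k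
  proof -
    define b where "b = (if k = i then m else x k)"
    have b: "y j \<le> b" if "\<alpha> j = k" for j
      using that m parentage_child[OF p, of j] by (auto simp: b_def)
    have b0: "0 \<le> b" using m S_down_nonneg[OF x] by (auto simp: b_def)
    have "(\<Sum>j\<in>{j\<in>J. \<alpha> j = k}. (y j)\<^sup>2) \<le> (\<Sum>j\<in>{j\<in>J. \<alpha> j = k}. b * y j)"
      using b S_down_nonneg[OF y] by (intro sum_mono) (auto simp: power2_eq_square intro!: mult_right_mono)
    also have "\<dots> = b * sum y {j\<in>J. \<alpha> j = k}"
      by (simp add: sum_distrib_left)
    also have "\<dots> \<le> b * x k"
      using p J b0 unfolding parentage_def by (intro mult_left_mono) auto
    also have "\<dots> = c k" by (auto simp: b_def c_def power2_eq_square)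
    finally show ?thesis .
  qed
  have c: "c sums ((\<Sum>k. (x k)\<^sup>2) + (m * x i - (x i)\<^sup>2))"
    unfolding c_def using sm by (intro sums_add summable_sums sums_single) auto
  have "(\<Sum>j\<in>J. (y j)\<^sup>2) = (\<Sum>k\<in>\<alpha> ` J. \<Sum>j\<in>{j\<in>J. \<alpha> j = k}. (y j)\<^sup>2)"
    using J by (intro sum.image_gen)
  also have "\<dots> \<le> (\<Sum>k\<in>\<alpha> ` J. c k)" by (intro sum_mono family)
  also have "\<dots> \<le> suminf c"
    using c c_nonneg J by (intro sum_le_suminf) (auto simp: sums_iff)
  also have "\<dots> = (\<Sum>k. (x k)\<^sup>2) - (x i)\<^sup>2 + m * x i"
    using c by (simp add: sums_iff)
  finally show ?thesis .
qed

lemma Q_mono: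
  assumes "y \<preceq> x" "x \<in> S_down" "y \<in> S_down"
  shows "Q y \<le> Q x"
proof (cases "Q x < \<infinity>")
  case True
  obtain \<alpha> where p: "parentage y x \<alpha>" using assms by (rule frag_le_parentage)
  note q = Q_eq_suminf[OF True]
  have "(\<Sum>j<n. ennreal ((y j)\<^sup>2)) \<le> Q x" for n
  proof -
    have "y j \<le> x 0" for j
      using parentage_child[OF p, of j] S_down_antimono[OF assms(2), of 0 "\<alpha> j"] by simp
    have "(\<Sum>j<n. (y j)\<^sup>2) \<le> (\<Sum>k. (x k)\<^sup>2) - (x 0)\<^sup>2 + x 0 * x 0"
      using p assms q(1) parentage_child[OF p] S_down_nonneg[OF assms(2)]
      by (intro sum_squares_children_le[where \<alpha> = \<alpha>]) (auto simp: parentage_def, metis)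
    then show ?thesis
      by (simp add: q(2) power2_eq_square sum_ennreal ennreal_leI)
  qed
  then show ?thesis
    unfolding Q_def[of y] by (intro suminf_le_const) auto
qed (simp add: not_less top_unique)

lemma parentage_Q_drop:
  assumes p: "parentage y x \<alpha>" and x: "x \<in> S_down" and y: "y \<in> S_down"
    and fin: "Q x < \<infinity>" "Q y < \<infinity>"
    and m: "\<And>j. \<alpha> j = i \<Longrightarrow> y j \<le> m" "0 \<le> m"
  shows "x i * (x i - m) \<le> enn2real (Q x) - enn2real (Q y)"
proof -
  have "(\<Sum>j. (y j)\<^sup>2) \<le> (\<Sum>k. (x k)\<^sup>2) - (x i)\<^sup>2 + m * x i"
    using Q_eq_suminf[OF fin(1)] Q_eq_suminf[OF fin(2)]
    by (intro suminf_le_const sum_squares_children_le[OF p x y _ m]) auto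
  then show ?thesis
    using Q_eq_suminf[OF fin(1)] Q_eq_suminf[OF fin(2)]
    by (simp add: suminf_nonneg power2_eq_square algebra_simps)
qed

text \<open>Each parent \<open>x k\<close> is within \<open>e\<close> of its first, hence largest, child \<open>y (l k)\<close>, because
  \<open>(x k - y (l k))\<^sup>2 \<le> x k * (x k - y (l k)) \<le> e\<^sup>2\<close>; a childless parent
  has size at most \<open>e\<close>.  The rest is a comparison of ranks.  From below, if \<open>x i > e\<close>: the
  largest children of the first \<open>i + 1\<close> parents are \<open>i + 1\<close> distinct entries of
  \<open>y\<close> of size at least \<open>x i - e\<close>.  From above: a fragment exceeding \<open>x i + e\<close> must have one of
  the first \<open>i\<close> parents, and no parent can have two children exceeding \<open>e\<close>.\<close>

lemma parentage_coordinate_close: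
  assumes p: "parentage y x \<alpha>" and x: "x \<in> S_down" and y: "y \<in> S_down"
    and fin: "Q x < \<infinity>" "Q y < \<infinity>"
    and e: "enn2real (Q x) - enn2real (Q y) \<le> e\<^sup>2" "0 \<le> e"
  shows "\<bar>x i - y i\<bar> \<le> e"
proof -
  define l where "l k = (LEAST j. \<alpha> j = k)" for k
  have childless: "x k \<le> e" if "\<And>j. \<alpha> j \<noteq> k" for k
  proof -
    have "(x k)\<^sup>2 \<le> e\<^sup>2"
      using parentage_Q_drop[OF p x y fin, of k 0] that e(1) by (auto simp: power2_eq_square)
    then show ?thesis using e(2) by (rule power2_le_imp_le)
  qed
  have l: "\<alpha> (l k) = k" and l_max: "x k - y (l k) \<le> e" if "\<exists>j. \<alpha> j = k" for k
  proof -
    show *: "\<alpha> (l k) = k" unfolding l_def by (rule LeastI_ex) (rule that)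
    have le: "y j \<le> y (l k)" if "\<alpha> j = k" for j
      by (rule S_down_antimono[OF y]) (simp add: l_def Least_le that)
    have yx: "y (l k) \<le> x k" using parentage_child[OF p, of "l k"] * by simp
    have "(x k - y (l k))\<^sup>2 \<le> x k * (x k - y (l k))"
      using yx S_down_nonneg[OF y, of "l k"]
      by (auto simp: power2_eq_square intro!: mult_right_mono)
    also have "\<dots> \<le> e\<^sup>2"
      using parentage_Q_drop[OF p x y fin, of k "y (l k)"] le e(1) S_down_nonneg[OF y] by force
    finally show "x k - y (l k) \<le> e" using e(2) by (rule power2_le_imp_le)
  qed
  have "x i - e \<le> y i"
  proof (cases "x i \<le> e")
    case True
    then show ?thesis using S_down_nonneg[OF y, of i] by simp
  next
    case False
    have ex: "\<exists>j. \<alpha> j = k" and big: "x i - e \<le> y (l k)" if "k \<le> i" for k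
    proof -
      have "x i \<le> x k" using S_down_antimono[OF x that] .
      with False childless[of k] show ex: "\<exists>j. \<alpha> j = k" by force
      show "x i - e \<le> y (l k)" using l_max[OF ex] \<open>x i \<le> x k\<close> by simp
    qed
    have "inj_on l {..i}"
      by (rule inj_on_inverseI[where g = \<alpha>]) (use ex l in auto)
    then have "card (l ` {..i}) = Suc i" by (simp add: card_image)
    then have "\<not> l ` {..i} \<subseteq> {..<i}"
      using card_mono[of "{..<i}" "l ` {..i}"] by auto
    then obtain k where "k \<le> i" "i \<le> l k" by force
    then show ?thesis using big[of k] S_down_antimono[OF y, of i "l k"] by simp
  qed
  moreover have "y i \<le> x i + e"
  proof (rule ccontr)
    assume "\<not> y i \<le> x i + e"
    then have y_big: "x i + e < y j" if "j \<le> i" for j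
      using S_down_antimono[OF y that] by simp
    have "\<alpha> j < i" if "j \<le> i" for j
    proof (rule ccontr)
      assume "\<not> \<alpha> j < i"
      then have "x (\<alpha> j) \<le> x i" using S_down_antimono[OF x, of i "\<alpha> j"] by simp
      then show False using parentage_child[OF p, of j] y_big[OF that] e(2) by simp
    qed
    then have "\<alpha> ` {..i} \<subseteq> {..<i}" by auto
    then have "card (\<alpha> ` {..i}) \<le> i" using card_mono[of "{..<i}" "\<alpha> ` {..i}"] by auto
    then have "\<not> inj_on \<alpha> {..i}" using card_image[of \<alpha> "{..i}"] by auto
    then obtain j0 j1 where j: "j0 \<le> i" "j1 \<le> i" "j0 \<noteq> j1" "\<alpha> j0 = \<alpha> j1"
      by (auto simp: inj_on_def)
    obtain j where j': "j \<le> i" "j \<noteq> l (\<alpha> j1)" "\<alpha> j = \<alpha> j1" using j by metis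
    have ex: "\<exists>j. \<alpha> j = \<alpha> j1" by blast
    have "y j + y (l (\<alpha> j1)) \<le> x (\<alpha> j1)"
      using parentage_siblings[OF p j'(2)] l[OF ex] j'(3) by simp
    then have "y j \<le> e" using l_max[OF ex] by simp
    then show False using y_big[OF j'(1)] S_down_nonneg[OF x, of i] by simp
  qed
  ultimately show ?thesis by simp
qed

text \<open>The factor \<open>2\<close> is the total weight \<open>\<Sum> (1/2)\<^sup>n\<close> of the product metric.\<close>

lemma dist_sequence_le:
  fixes x y :: "nat \<Rightarrow> real"
  assumes "\<And>i. \<bar>x i - y i\<bar> \<le> e"
  shows "dist x y \<le> 2 * e"
proof -
  have sm: "summable (\<lambda>n. (1/2)^n * min (dist (x (from_nat n)) (y (from_nat n))) 1)"
    by (rule summable_comparison_test'[of "\<lambda>n. (1/2)^n"]) (auto simp: summable_geometric_iff)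
  have g: "(\<lambda>n. (1/2)^n * e) sums (2 * e)"
    using sums_mult2[OF geometric_sums[of "1/2::real"], of e] by simp
  have "dist x y \<le> (\<Sum>n. (1/2)^n * e)"
    unfolding dist_fun_def using assms g sm
    by (intro suminf_le) (auto simp: dist_real_def min_le_iff_disj sums_iff)
  then show ?thesis using g by (simp add: sums_iff)
qed

lemma dist_le_sqrt_Q_drop:
  assumes "y \<preceq> x" "x \<in> S_down" "y \<in> S_down" "Q x < \<infinity>"
  shows "dist y x \<le> 2 * sqrt (enn2real (Q x) - enn2real (Q y))"
proof -
  obtain \<alpha> where p: "parentage y x \<alpha>" using assms(1-3) by (rule frag_le_parentage)
  have le: "Q y \<le> Q x" by (rule Q_mono) fact+
  have "enn2real (Q y) \<le> enn2real (Q x)" using le assms(4) by (simp add: enn2real_mono)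
  then have "\<bar>y i - x i\<bar> \<le> sqrt (enn2real (Q x) - enn2real (Q y))" for i
    using parentage_coordinate_close[OF p assms(2,3,4), of "sqrt (enn2real (Q x) - enn2real (Q y))" i]
      le assms(4) by (simp add: abs_minus_commute)
  then show ?thesis by (rule dist_sequence_le)
qed

lemma frag_le_first:
  assumes "y \<preceq> x" "x \<in> S_down" "y \<in> S_down"
  shows "y 0 \<le> x 0"
proof -
  obtain \<alpha> where p: "parentage y x \<alpha>" using assms by (rule frag_le_parentage)
  show ?thesis using parentage_child[OF p, of 0] S_down_antimono[OF assms(2), of 0 "\<alpha> 0"] by simp
qed

section \<open>A sequential criterion for compactness in the J1 topology\<close>

text \<open>Composing time changes gives a triangle inequality; the horizon shrinks by the time distortion
  of the inner change.  Together with the symmetry below, it lets the neighbourhoods serve as the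
  entourages of a uniformity.\<close>

lemma skorohod_nbhd_trans:
  assumes y: "y \<in> skorohod_nbhd S x T' d" and z: "z \<in> skorohod_nbhd S y T e" and T: "T + e \<le> T'"
  shows "z \<in> skorohod_nbhd S x T (d + e)"
proof -
  obtain \<theta> where \<theta>: "time_change \<theta>"
    "\<And>t. t \<in> {0..T'} \<Longrightarrow> \<bar>\<theta> t - t\<bar> < d \<and> dist (y t) (x (\<theta> t)) < d"
    using y unfolding skorohod_nbhd_def by blast
  obtain \<phi> where \<phi>: "z \<in> skorohod_space S" "time_change \<phi>"
    "\<And>t. t \<in> {0..T} \<Longrightarrow> \<bar>\<phi> t - t\<bar> < e \<and> dist (z t) (y (\<phi> t)) < e"
    using z unfolding skorohod_nbhd_def by blast
  have "time_change (\<theta> \<circ> \<phi>)"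
    using \<theta>(1) \<phi>(2) unfolding time_change_def
    by (auto intro: bij_betw_trans simp: strict_mono_on_def dest: bij_betwE)
  moreover have "\<bar>(\<theta> \<circ> \<phi>) t - t\<bar> < d + e \<and> dist (z t) (x ((\<theta> \<circ> \<phi>) t)) < d + e"
    if t: "t \<in> {0..T}" for t
  proof -
    have "\<phi> t \<in> {0..}"
      using \<phi>(2) t by (auto simp: time_change_def bij_betw_def)
    then have "\<phi> t \<in> {0..T'}" using \<phi>(3)[OF t] T t by auto
    from \<theta>(2)[OF this] \<phi>(3)[OF t] show ?thesis
      using dist_triangle[of "z t" "x (\<theta> (\<phi> t))" "y (\<phi> t)"] by (auto simp: abs_less_iff)
  qed
  ultimately show ?thesis using \<phi>(1) unfolding skorohod_nbhd_def by blast
qed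

lemma skorohod_nbhd_sym:
  assumes y: "y \<in> skorohod_nbhd S x T' e" and x: "x \<in> skorohod_space S" and T: "T + e \<le> T'" "0 \<le> T'"
  shows "x \<in> skorohod_nbhd S y T e"
proof -
  obtain \<theta> where \<theta>: "time_change \<theta>"
    "\<And>t. t \<in> {0..T'} \<Longrightarrow> \<bar>\<theta> t - t\<bar> < e \<and> dist (y t) (x (\<theta> t)) < e"
    using y unfolding skorohod_nbhd_def by blast
  define \<phi> where "\<phi> = the_inv_into {0..} \<theta>"
  have inj: "inj_on \<theta> {0..}" and im: "\<theta> ` {0..} = {0..}" and
    sm: "\<And>s t. 0 \<le> s \<Longrightarrow> 0 \<le> t \<Longrightarrow> s < t \<Longrightarrow> \<theta> s < \<theta> t"
    using \<theta>(1) by (auto simp: time_change_def bij_betw_def strict_mono_on_def)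
  have \<phi>: "0 \<le> \<phi> t" "\<theta> (\<phi> t) = t" if "0 \<le> t" for t
    using the_inv_into_into[OF inj, of t "{0..}"] f_the_inv_into_f[OF inj, of t] im that
    by (auto simp: \<phi>_def)
  have "bij_betw \<phi> {0..} {0..}"
    unfolding \<phi>_def using \<theta>(1) by (simp add: time_change_def bij_betw_the_inv_into)
  moreover have "strict_mono_on {0..} \<phi>"
  proof (rule strict_mono_onI)
    fix r s :: real assume "r \<in> {0..}" "s \<in> {0..}" "r < s"
    then show "\<phi> r < \<phi> s"
      using sm[of "\<phi> s" "\<phi> r"] \<phi>[of r] \<phi>[of s] by (metis atLeast_iff linorder_less_linear less_asym)
  qed
  moreover have "\<bar>\<phi> t - t\<bar> < e \<and> dist (x t) (y (\<phi> t)) < e" if t: "t \<in> {0..T}" for t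
  proof -
    have "\<phi> t \<le> T'"
    proof (rule ccontr)
      assume "\<not> \<phi> t \<le> T'"
      then have "\<theta> T' < t" using sm[of T' "\<phi> t"] \<phi>[of t] t T by auto
      then show False using \<theta>(2)[of T'] T t by auto
    qed
    then show ?thesis
      using \<theta>(2)[of "\<phi> t"] \<phi>[of t] t by (auto simp: dist_commute abs_minus_commute)
  qed
  ultimately show ?thesis using x unfolding skorohod_nbhd_def time_change_def by blast
qed

text \<open>The classical proof that sequentially compact metric spaces are compact (a Lebesgue number for the
  cover, then total boundedness), carried out directly with the neighbourhoods that define the
  topology, so that no metric has to be constructed.\<close>

lemma compactin_skorohod_J1I:
  fixes S :: "'b::metric_space set"
  assumes K: "K \<subseteq> skorohod_space S"
    and seq: "\<And>f :: nat \<Rightarrow> real \<Rightarrow> 'b. (\<And>n. f n \<in> K) \<Longrightarrow>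
      \<exists>x\<in>K. \<exists>r :: nat \<Rightarrow> nat. strict_mono r \<and>
        (\<forall>T e. 0 < e \<longrightarrow> (\<forall>\<^sub>F n in sequentially. f (r n) \<in> skorohod_nbhd S x T e))"
  shows "compactin (skorohod_J1 S) K"
  unfolding compactin_def topspace_skorohod_J1
proof (intro conjI allI impI)
  show "K \<subseteq> skorohod_space S" by fact
  fix \<U> assume U: "Ball \<U> (openin (skorohod_J1 S)) \<and> K \<subseteq> \<Union> \<U>"
  have Lebesgue_number: "\<exists>m. \<forall>x\<in>K. \<exists>U\<in>\<U>. skorohod_nbhd S x (real m) (1 / Suc m) \<subseteq> U"
  proof (rule ccontr)
    assume "\<not> ?thesis"
    then obtain f where f: "\<And>m. f m \<in> K"
      "\<And>m U. U \<in> \<U> \<Longrightarrow> \<not> skorohod_nbhd S (f m) (real m) (1 / Suc m) \<subseteq> U"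
      by metis
    obtain x r where x: "x \<in> K" and r: "strict_mono r" and
      lim: "\<And>T e. 0 < e \<Longrightarrow> \<forall>\<^sub>F n in sequentially. f (r n) \<in> skorohod_nbhd S x T e"
      using seq[of f] f(1) by blast
    obtain U where "U \<in> \<U>" "x \<in> U" using U x by blast
    then obtain T e where e: "T > 0" "e > 0" "skorohod_nbhd S x T e \<subseteq> U"
      using U unfolding openin_skorohod_J1 by meson
    have ev: "\<forall>\<^sub>F n in sequentially. T + 1 \<le> real (r n) \<and> 1 / Suc (r n) < e / 2"
    proof -
      have "\<forall>\<^sub>F n in sequentially. T + 1 \<le> real n \<and> 1 / Suc n < e / 2"
      proof (rule eventually_conj)
        show "\<forall>\<^sub>F n in sequentially. T + 1 \<le> real n"
          using filterlim_real_sequentially by (simp add: filterlim_at_top)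
        show "\<forall>\<^sub>F n in sequentially. 1 / real (Suc n) < e / 2"
          using LIMSEQ_inverse_real_of_nat e(2)
          by (intro order_tendstoD(2)[where y = 0]) (simp_all add: inverse_eq_divide)
      qed
      then show ?thesis using r by (rule eventually_subseq[rotated])
    qed
    obtain n where n: "f (r n) \<in> skorohod_nbhd S x (T + 1) (e / 2)"
      "T + 1 \<le> real (r n)" "1 / Suc (r n) < e / 2"
      using eventually_conj[OF lim[of "e / 2" "T + 1"] ev] e(2)
      by (auto dest: eventually_happens)
    have "skorohod_nbhd S (f (r n)) (real (r n)) (1 / Suc (r n)) \<subseteq> U"
    proof
      fix y assume "y \<in> skorohod_nbhd S (f (r n)) (real (r n)) (1 / Suc (r n))"
      then have "y \<in> skorohod_nbhd S (f (r n)) T (1 / Suc (r n))"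
        using skorohod_nbhd_mono[of T "real (r n)"] n(2) by fastforce
      with n(1) have "y \<in> skorohod_nbhd S x T (e / 2 + 1 / Suc (r n))"
        by (rule skorohod_nbhd_trans) (simp add: field_simps)
      then show "y \<in> U"
        using skorohod_nbhd_mono[of T T "e / 2 + 1 / Suc (r n)" e S x] n(3) e(3) by auto
    qed
    then show False using f(2) \<open>U \<in> \<U>\<close> by blast
  qed
  have totally_bounded:
    "\<exists>A. finite A \<and> A \<subseteq> K \<and> K \<subseteq> (\<Union>x\<in>A. skorohod_nbhd S x T e)" if e: "0 < e" "0 \<le> T" for T e
  proof (rule ccontr)
    assume none: "\<not> ?thesis"
    have "\<exists>f. \<forall>n::nat. f n \<in> K \<and> (\<forall>m<n. f n \<notin> skorohod_nbhd S (f m) T e)"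
    proof (rule dependent_wellorder_choice)
      fix n and f :: "nat \<Rightarrow> real \<Rightarrow> 'b"
      assume "\<And>m. m < n \<Longrightarrow> f m \<in> K \<and> (\<forall>k<m. f m \<notin> skorohod_nbhd S (f k) T e)"
      then have "f ` {..<n} \<subseteq> K" by auto
      then have "\<not> K \<subseteq> (\<Union>x\<in>f ` {..<n}. skorohod_nbhd S x T e)" using none by blast
      then show "\<exists>y. y \<in> K \<and> (\<forall>m<n. y \<notin> skorohod_nbhd S (f m) T e)" by blast
    qed auto
    then obtain f where *: "\<forall>n::nat. f n \<in> K \<and> (\<forall>m<n. f n \<notin> skorohod_nbhd S (f m) T e)" ..
    then have f: "f n \<in> K" "m < n \<Longrightarrow> f n \<notin> skorohod_nbhd S (f m) T e" for m n
      by simp_all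
    obtain x r where x: "x \<in> K" and r: "strict_mono r" and
      lim: "\<And>T e. 0 < e \<Longrightarrow> \<forall>\<^sub>F n in sequentially. f (r n) \<in> skorohod_nbhd S x T e"
      using seq[of f] f(1) by blast
    obtain N where N: "\<And>n. N \<le> n \<Longrightarrow> f (r n) \<in> skorohod_nbhd S x (T + e) (e / 2)"
      using lim[of "e / 2" "T + e"] e by (auto simp: eventually_sequentially)
    have "x \<in> skorohod_nbhd S (f (r N)) (T + e / 2) (e / 2)"
      using e K x by (intro skorohod_nbhd_sym[OF N[of N]]) auto
    moreover have "f (r (Suc N)) \<in> skorohod_nbhd S x T (e / 2)"
      using N[of "Suc N"] e skorohod_nbhd_mono[of T "T + e" "e / 2" "e / 2" S x] by auto
    ultimately have "f (r (Suc N)) \<in> skorohod_nbhd S (f (r N)) T (e / 2 + e / 2)"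
      by (rule skorohod_nbhd_trans) simp
    moreover have "r N < r (Suc N)" using r by (simp add: strict_mono_def)
    ultimately show False using f(2)[of "r N" "r (Suc N)"] by simp
  qed
  obtain m where "\<forall>x\<in>K. \<exists>U\<in>\<U>. skorohod_nbhd S x (real m) (1 / Suc m) \<subseteq> U"
    using Lebesgue_number by blast
  then obtain u where u: "\<And>x. x \<in> K \<Longrightarrow> u x \<in> \<U>"
    "\<And>x. x \<in> K \<Longrightarrow> skorohod_nbhd S x (real m) (1 / Suc m) \<subseteq> u x"
    by metis
  obtain A where A: "finite A" "A \<subseteq> K" "K \<subseteq> (\<Union>x\<in>A. skorohod_nbhd S x (real m) (1 / Suc m))"
    using totally_bounded[of "1 / Suc m" "real m"] by auto
  show "\<exists>\<F>. finite \<F> \<and> \<F> \<subseteq> \<U> \<and> K \<subseteq> \<Union> \<F>"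
    using A u by (intro exI[of _ "u ` A"]) blast
qed

section \<open>Sparse partitions and paths that are nearly step functions\<close>

text \<open>Partitions of the half-line with gaps at least \<open>\<delta>\<close>.  The upper bound on \<open>t i\<close>, which
  only constrains points beyond \<open>T\<close>, makes the set of partitions compact.\<close>

definition sparse_partitions :: "real \<Rightarrow> real \<Rightarrow> (nat \<Rightarrow> real) set" where
  "sparse_partitions T \<delta> =
     {t. t 0 = 0 \<and> (\<forall>i. t i + \<delta> \<le> t (Suc i)) \<and> (\<forall>i. t i \<le> T + real i * \<delta>)}"

text \<open>Tychonoff's theorem for countably many factors.\<close>

lemma compact_functions:
  fixes C :: "'a::countable \<Rightarrow> 'b::metric_space set"
  assumes "\<And>i. compact (C i)"
  shows "compact {f. \<forall>i. f i \<in> C i}"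
proof -
  have "compactin (product_topology (\<lambda>i. euclidean) UNIV) (Pi\<^sub>E UNIV C)"
    using assms by (simp add: compactin_PiE)
  moreover have "Pi\<^sub>E UNIV C = {f. \<forall>i. f i \<in> C i}" by (auto simp: PiE_iff)
  ultimately show ?thesis by (simp add: euclidean_product_topology)
qed

lemma tendsto_coordinate:
  fixes f :: "'a \<Rightarrow> 'i \<Rightarrow> 'b::topological_space"
  assumes "(f \<longlongrightarrow> l) F"
  shows "((\<lambda>n. f n i) \<longlongrightarrow> l i) F"
  by (rule continuous_on_tendsto_compose[OF continuous_on_product_coordinates assms]) auto

lemma sparse_partition_ge:
  assumes t: "t \<in> sparse_partitions T \<delta>"
  shows "real i * \<delta> \<le> t i"
proof (induction i)
  case 0
  show ?case using t by (simp add: sparse_partitions_def)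
next
  case (Suc i)
  moreover have "t i + \<delta> \<le> t (Suc i)" using t by (simp add: sparse_partitions_def)
  ultimately show ?case by (simp add: algebra_simps)
qed

lemma compact_sparse_partitions: "compact (sparse_partitions T \<delta>)"
proof -
  let ?B = "{t. \<forall>i. t i \<in> {-\<bar>real i * \<delta>\<bar>..T + real i * \<delta>}}"
  have "compact ?B" by (rule compact_functions) simp
  moreover have "closed (sparse_partitions T \<delta>)"
  proof -
    have c: "continuous_on UNIV (\<lambda>t::nat \<Rightarrow> real. t i)" for i
      by (rule continuous_on_product_coordinates)
    show ?thesis
      unfolding sparse_partitions_def
      by (intro closed_Collect_conj closed_Collect_all closed_Collect_le closed_Collect_eq
          continuous_intros c)
  qed
  moreover have "sparse_partitions T \<delta> \<subseteq> ?B"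
  proof
    fix t assume t: "t \<in> sparse_partitions T \<delta>"
    then have "-\<bar>real i * \<delta>\<bar> \<le> t i" for i
      using sparse_partition_ge[OF t, of i] by (simp add: abs_if split: if_splits)
    then show "t \<in> ?B" using t by (auto simp: sparse_partitions_def)
  qed
  ultimately show ?thesis using compact_Int_closed[of ?B "sparse_partitions T \<delta>"]
    by (simp add: Int_absorb1)
qed

context
  fixes T \<delta> :: real and t :: "nat \<Rightarrow> real"
  assumes t: "t \<in> sparse_partitions T \<delta>" and \<delta>: "0 < \<delta>"
begin

lemma sparse_partition_0: "t 0 = 0"
  using t by (simp add: sparse_partitions_def)

lemma sparse_partition_Suc: "t i < t (Suc i)"
  using t \<delta> by (auto simp: sparse_partitions_def dest: spec[of _ i])

lemma sparse_partition_mono: "i \<le> k \<Longrightarrow> t i \<le> t k"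
  using lift_Suc_mono_le[of t] sparse_partition_Suc by (simp add: less_imp_le)

lemma sparse_partition_unbounded: "\<exists>i. s < t i"
proof -
  obtain i where "s < real i * \<delta>" using reals_Archimedean3[OF \<delta>] by blast
  then show ?thesis using sparse_partition_ge[OF t, of i] by (auto intro: exI[of _ i])
qed

lemma sparse_partition_piece:
  assumes "0 \<le> s"
  shows "\<exists>i. s \<in> {t i..<t (Suc i)}"
proof -
  define k where "k = (LEAST k. s < t k)"
  have k: "s < t k" unfolding k_def using sparse_partition_unbounded by (rule LeastI_ex)
  then obtain i where i: "k = Suc i" using assms sparse_partition_0 by (cases k) auto
  then have "\<not> s < t i" using not_less_Least[of i "\<lambda>k. s < t k"] by (simp add: k_def)
  then show ?thesis using k i by (intro exI[of _ i]) auto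
qed

lemma sparse_partition_left_piece:
  assumes "0 < s"
  shows "\<exists>i. s \<in> {t i<..t (Suc i)}"
proof -
  define k where "k = (LEAST k. s \<le> t k)"
  have k: "s \<le> t k"
    unfolding k_def using sparse_partition_unbounded less_imp_le by (metis LeastI_ex)
  then obtain i where i: "k = Suc i" using assms sparse_partition_0 by (cases k) auto
  then have "\<not> s \<le> t i" using not_less_Least[of i "\<lambda>k. s \<le> t k"] by (simp add: k_def)
  then show ?thesis using k i by (intro exI[of _ i]) auto
qed

lemma sparse_partition_piece_mono:
  assumes "s \<in> {t i..<t (Suc i)}" "s' \<in> {t k..<t (Suc k)}" "s \<le> s'"
  shows "i \<le> k"
proof (rule ccontr)
  assume "\<not> i \<le> k"
  then have "t (Suc k) \<le> t i" by (intro sparse_partition_mono) simp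
  then show False using assms by simp
qed

end

text \<open>The time change that maps the points of \<open>a\<close> to those of \<open>b\<close> and interpolates linearly.  As
  \<open>\<theta> s - s\<close> is a convex combination of its values at the two neighbouring points of \<open>a\<close>, the
  distortion is controlled by the distance between corresponding points.\<close>

lemma piecewise_linear_time_change:
  assumes a: "a \<in> sparse_partitions T \<delta>" and b: "b \<in> sparse_partitions T \<delta>" and \<delta>: "0 < \<delta>"
  obtains \<theta> where "time_change \<theta>"
    "\<And>i s. s \<in> {a i..<a (Suc i)} \<Longrightarrow> \<theta> s \<in> {b i..<b (Suc i)}"
    "\<And>i s. s \<in> {a i..<a (Suc i)} \<Longrightarrow> \<bar>\<theta> s - s\<bar> \<le> max \<bar>b i - a i\<bar> \<bar>b (Suc i) - a (Suc i)\<bar>"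
proof -
  note a_Suc = sparse_partition_Suc[OF a \<delta>] and b_Suc = sparse_partition_Suc[OF b \<delta>]
  obtain N where N: "\<And>s. 0 \<le> s \<Longrightarrow> s \<in> {a (N s)..<a (Suc (N s))}"
    using sparse_partition_piece[OF a \<delta>] by metis
  define l where "l i s = (s - a i) / (a (Suc i) - a i)" for i s
  define \<theta> where "\<theta> s = b (N s) + l (N s) s * (b (Suc (N s)) - b (N s))" for s
  have nonneg: "0 \<le> s" if "s \<in> {a i..<a (Suc i)}" for i s
    using sparse_partition_mono[OF a \<delta>, of 0 i] sparse_partition_0[OF a \<delta>] that by simp
  have N_eq: "N s = i" if "s \<in> {a i..<a (Suc i)}" for i s
    using sparse_partition_piece_mono[OF a \<delta> that N[OF nonneg[OF that]]]
      sparse_partition_piece_mono[OF a \<delta> N[OF nonneg[OF that]] that] by simp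
  have l: "0 \<le> l i s" "l i s < 1" "s = a i + l i s * (a (Suc i) - a i)"
    if "s \<in> {a i..<a (Suc i)}" for i s
    using a_Suc[of i] that by (auto simp: l_def)
  have piece: "\<theta> s \<in> {b i..<b (Suc i)}" if "s \<in> {a i..<a (Suc i)}" for i s
  proof -
    have "l i s * (b (Suc i) - b i) < 1 * (b (Suc i) - b i)"
      using l[OF that] b_Suc[of i] by (intro mult_strict_right_mono) auto
    moreover have "0 \<le> l i s * (b (Suc i) - b i)"
      using l[OF that] b_Suc[of i] by simp
    ultimately show ?thesis using N_eq[OF that] by (simp add: \<theta>_def)
  qed
  have near: "\<bar>\<theta> s - s\<bar> \<le> max \<bar>b i - a i\<bar> \<bar>b (Suc i) - a (Suc i)\<bar>"
    if "s \<in> {a i..<a (Suc i)}" for i s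
  proof -
    define m where "m = max \<bar>b i - a i\<bar> \<bar>b (Suc i) - a (Suc i)\<bar>"
    note ls = l[OF that]
    have "\<theta> s - s = (1 - l i s) * (b i - a i) + l i s * (b (Suc i) - a (Suc i))"
      using ls(3) N_eq[OF that] by (simp add: \<theta>_def algebra_simps)
    also have "\<bar>\<dots>\<bar> \<le> (1 - l i s) * m + l i s * m"
      using ls by (intro order_trans[OF abs_triangle_ineq] add_mono)
        (auto simp: abs_mult m_def intro!: mult_left_mono)
    also have "\<dots> = m" by (simp add: algebra_simps)
    finally show ?thesis by (simp add: m_def)
  qed
  have b_nonneg: "0 \<le> b i" for i
    using sparse_partition_mono[OF b \<delta>, of 0 i] sparse_partition_0[OF b \<delta>] by simp
  have sm: "\<theta> r < \<theta> s" if "0 \<le> r" "r < s" for r s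
  proof (cases "N r = N s")
    case True
    then have "l (N r) r < l (N s) s"
      using that a_Suc[of "N s"] by (simp add: l_def divide_strict_right_mono)
    then show ?thesis using True b_Suc[of "N s"] by (simp add: \<theta>_def)
  next
    case False
    then have "N r < N s"
      using sparse_partition_piece_mono[OF a \<delta> N N, of r s] that by simp
    then have "b (Suc (N r)) \<le> b (N s)" by (intro sparse_partition_mono[OF b \<delta>]) simp
    then show ?thesis using piece[OF N[of r]] piece[OF N[of s]] that by simp
  qed
  have "time_change \<theta>"
    unfolding time_change_def
  proof
    show "strict_mono_on {0..} \<theta>" using sm by (intro strict_mono_onI) auto
    then have "inj_on \<theta> {0..}" by (rule strict_mono_on_imp_inj_on)
    moreover have "\<theta> ` {0..} = {0..}"
    proof
      show "\<theta> ` {0..} \<subseteq> {0..}"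
      proof
        fix u assume "u \<in> \<theta> ` {0..}"
        then obtain s where s: "0 \<le> s" "u = \<theta> s" by auto
        show "u \<in> {0..}" using piece[OF N[OF s(1)]] b_nonneg[of "N s"] s by simp
      qed
      show "{0..} \<subseteq> \<theta> ` {0..}"
      proof
        fix u :: real assume "u \<in> {0..}"
        then obtain i where i: "u \<in> {b i..<b (Suc i)}"
          using sparse_partition_piece[OF b \<delta>, of u] by auto
        define m where "m = (u - b i) / (b (Suc i) - b i)"
        define s where "s = a i + m * (a (Suc i) - a i)"
        have m: "0 \<le> m" "m < 1" "u = b i + m * (b (Suc i) - b i)"
          using i b_Suc[of i] by (auto simp: m_def)
        have s: "s \<in> {a i..<a (Suc i)}"
        proof -
          have "m * (a (Suc i) - a i) < 1 * (a (Suc i) - a i)"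
            using m a_Suc[of i] by (intro mult_strict_right_mono) auto
          moreover have "0 \<le> m * (a (Suc i) - a i)" using m a_Suc[of i] by simp
          ultimately show ?thesis by (simp add: s_def)
        qed
        moreover have "l i s = m" using a_Suc[of i] by (simp add: l_def s_def)
        ultimately have "\<theta> s = u" using N_eq[OF s] m(3) by (simp add: \<theta>_def)
        then show "u \<in> \<theta> ` {0..}" using nonneg[OF s] by auto
      qed
    qed
    ultimately show "bij_betw \<theta> {0..} {0..}" by (simp add: bij_betw_def)
  qed
  then show ?thesis using piece near by (rule that)
qed

text \<open>The set \<open>A\<close> of times at which the path is observed is \<^term>\<open>UNIV :: real set\<close> for the condition
  itself, and finite when the condition is tested by countably many events.\<close>

definition osc_le :: "real \<Rightarrow> real \<Rightarrow> real set \<Rightarrow> (nat \<Rightarrow> real) \<Rightarrow> (real \<Rightarrow> 'b::metric_space) \<Rightarrow> bool" where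
  "osc_le T \<epsilon> A t x \<longleftrightarrow>
     (\<forall>i. \<forall>r\<in>A \<inter> {t i..<t (Suc i)}. \<forall>s\<in>A \<inter> {t i..<t (Suc i)}. r < T \<longrightarrow> s < T \<longrightarrow> dist (x r) (x s) \<le> \<epsilon>)"

text \<open>A bound on Billingsley's modulus \<open>w'\<close>, the modulus of continuity adapted to cadlag functions: up
  to the error \<open>\<epsilon>\<close>, the path is a step function on \<open>[0, T)\<close> with steps no shorter than \<open>\<delta>\<close>.\<close>

definition nearly_step :: "real \<Rightarrow> real \<Rightarrow> real \<Rightarrow> (real \<Rightarrow> 'b::metric_space) \<Rightarrow> bool" where
  "nearly_step T \<delta> \<epsilon> x \<longleftrightarrow> (\<exists>t\<in>sparse_partitions T \<delta>. osc_le T \<epsilon> UNIV t x)"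

lemma eventually_in_piece:
  fixes \<tau> :: "'a \<Rightarrow> nat \<Rightarrow> real"
  assumes "(\<tau> \<longlongrightarrow> t) F" "s \<in> {t i<..<t (Suc i)}"
  shows "\<forall>\<^sub>F n in F. s \<in> {\<tau> n i..<\<tau> n (Suc i)}"
  using order_tendstoD(2)[OF tendsto_coordinate[OF assms(1), of i], of s]
    order_tendstoD(1)[OF tendsto_coordinate[OF assms(1), of "Suc i"], of s] assms(2)
  by (auto elim: eventually_elim2)

lemma rational_near_right_limit:
  fixes x :: "real \<Rightarrow> 'b::metric_space"
  assumes "(x \<longlongrightarrow> l) (at_right s)" "s < u" "0 < e"
  shows "\<exists>r\<in>\<rat>. s < r \<and> r < u \<and> dist (x r) l < e"
proof -
  have "\<forall>\<^sub>F r in at_right s. r < u \<and> dist (x r) l < e"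
    using assms by (auto intro!: eventually_conj order_tendstoD(2)[OF tendsto_ident_at] dest: tendstoD)
  then obtain b where b: "s < b" "\<And>r. s < r \<Longrightarrow> r < b \<Longrightarrow> r < u \<and> dist (x r) l < e"
    unfolding eventually_at_right_field by blast
  obtain r where "r \<in> \<rat>" "s < r" "r < b" using Rats_dense_in_real[OF b(1)] by blast
  then show ?thesis using b(2) by blast
qed

text \<open>By right continuity every value, also the one at the left end of a piece, is approximated by values
  at rational times in the interior of the same piece.\<close>

lemma osc_leI_rational:
  assumes t: "t \<in> sparse_partitions T \<delta>" "0 < \<delta>"
    and rc: "\<And>s. 0 \<le> s \<Longrightarrow> (x \<longlongrightarrow> x s) (at_right s)"
    and osc: "\<And>i r s. r \<in> \<rat> \<Longrightarrow> s \<in> \<rat> \<Longrightarrow> r \<in> {t i<..<t (Suc i)} \<Longrightarrow> s \<in> {t i<..<t (Suc i)} \<Longrightarrow>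
      r < T \<Longrightarrow> s < T \<Longrightarrow> dist (x r) (x s) \<le> \<epsilon>"
  shows "osc_le T \<epsilon> UNIV t x"
  unfolding osc_le_def
proof (intro allI ballI impI)
  fix i r s assume r: "r \<in> UNIV \<inter> {t i..<t (Suc i)}" "r < T" and s: "s \<in> UNIV \<inter> {t i..<t (Suc i)}" "s < T"
  have "0 \<le> t i"
    using sparse_partition_mono[OF t, of 0 i] sparse_partition_0[OF t] by simp
  show "dist (x r) (x s) \<le> \<epsilon>"
  proof (rule field_le_epsilon)
    fix e :: real assume e: "0 < e"
    obtain r' where r': "r' \<in> \<rat>" "r < r'" "r' < min (t (Suc i)) T" "dist (x r') (x r) < e / 2"
      using rational_near_right_limit[OF rc, of r "min (t (Suc i)) T" "e / 2"] r \<open>0 \<le> t i\<close> e by auto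
    obtain s' where s': "s' \<in> \<rat>" "s < s'" "s' < min (t (Suc i)) T" "dist (x s') (x s) < e / 2"
      using rational_near_right_limit[OF rc, of s "min (t (Suc i)) T" "e / 2"] s \<open>0 \<le> t i\<close> e by auto
    have "dist (x r') (x s') \<le> \<epsilon>" using r r' s s' by (intro osc) auto
    then show "dist (x r) (x s) \<le> \<epsilon> + e"
      using r'(4) s'(4) dist_triangle2[of "x r" "x s" "x r'"] dist_triangle[of "x s" "x r'" "x s'"]
      by (smt (verit) dist_commute dist_triangle field_sum_of_halves)
  qed
qed

text \<open>For growing finite sets of rational times, the partitions found for them have a convergent
  subsequence, since sparse partitions form a compact set.  Two rational times in the interior of
  a piece of the limit eventually lie in one piece of the approximating partitions.\<close>

lemma nearly_step_iff_rational:
  assumes \<delta>: "0 < \<delta>" and rc: "\<And>s. 0 \<le> s \<Longrightarrow> (x \<longlongrightarrow> x s) (at_right s)"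
  shows "nearly_step T \<delta> \<epsilon> x \<longleftrightarrow>
    (\<forall>F. finite F \<and> F \<subseteq> \<rat> \<inter> {0..} \<longrightarrow> (\<exists>t\<in>sparse_partitions T \<delta>. osc_le T \<epsilon> F t x))"
proof
  assume "nearly_step T \<delta> \<epsilon> x"
  then show "\<forall>F. finite F \<and> F \<subseteq> \<rat> \<inter> {0..} \<longrightarrow> (\<exists>t\<in>sparse_partitions T \<delta>. osc_le T \<epsilon> F t x)"
    unfolding nearly_step_def osc_le_def by blast
next
  assume fin: "\<forall>F. finite F \<and> F \<subseteq> \<rat> \<inter> {0..} \<longrightarrow> (\<exists>t\<in>sparse_partitions T \<delta>. osc_le T \<epsilon> F t x)"
  let ?A = "\<rat> \<inter> {0::real..}"
  have A: "countable ?A" "?A \<noteq> {}" by (auto simp: countable_rat)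
  define F where "F n = from_nat_into ?A ` {..n}" for n
  have F: "finite (F n)" "F n \<subseteq> ?A" for n
    using from_nat_into[OF A(2)] by (auto simp: F_def)
  have F_ev: "\<forall>\<^sub>F n in sequentially. r \<in> F n" if r: "r \<in> ?A" for r
  proof -
    obtain m where "r = from_nat_into ?A m" using from_nat_into_surj[OF A(1) r] by metis
    then show ?thesis unfolding eventually_sequentially F_def by auto
  qed
  obtain \<tau> where \<tau>: "\<And>n. \<tau> n \<in> sparse_partitions T \<delta>" "\<And>n. osc_le T \<epsilon> (F n) (\<tau> n) x"
  proof -
    have "\<exists>t\<in>sparse_partitions T \<delta>. osc_le T \<epsilon> (F n) t x" for n
      using F by (intro fin[rule_format]) simp
    then show thesis using that by metis
  qed
  obtain t r where t: "t \<in> sparse_partitions T \<delta>" and r: "strict_mono r" "(\<tau> \<circ> r) \<longlonglongrightarrow> t"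
    using seq_compactE[OF compact_imp_seq_compact[OF compact_sparse_partitions[of T \<delta>]], of \<tau>] \<tau>(1)
    by metis
  have "osc_le T \<epsilon> UNIV t x"
  proof (rule osc_leI_rational[OF t \<delta> rc])
    fix i u s assume u: "u \<in> \<rat>" "u \<in> {t i<..<t (Suc i)}" "u < T"
      and s: "s \<in> \<rat>" "s \<in> {t i<..<t (Suc i)}" "s < T"
    have "0 \<le> t i"
      using sparse_partition_mono[OF t \<delta>, of 0 i] sparse_partition_0[OF t \<delta>] by simp
    then have us: "u \<in> ?A" "s \<in> ?A" using u s by auto
    have "\<forall>\<^sub>F n in sequentially. u \<in> F (r n) \<and> s \<in> F (r n) \<and>
        u \<in> {(\<tau> \<circ> r) n i..<(\<tau> \<circ> r) n (Suc i)} \<and> s \<in> {(\<tau> \<circ> r) n i..<(\<tau> \<circ> r) n (Suc i)}"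
      using u s us
      by (intro eventually_conj eventually_in_piece[OF r(2)] eventually_subseq[OF r(1)] F_ev) auto
    then obtain n where "u \<in> F (r n) \<inter> {\<tau> (r n) i..<\<tau> (r n) (Suc i)}"
      "s \<in> F (r n) \<inter> {\<tau> (r n) i..<\<tau> (r n) (Suc i)}"
      by (auto dest!: eventually_happens)
    then show "dist (x u) (x s) \<le> \<epsilon>" using \<tau>(2)[of "r n"] u(3) s(3) unfolding osc_le_def by blast
  qed auto
  then show "nearly_step T \<delta> \<epsilon> x" using t unfolding nearly_step_def by blast
qed

section \<open>A compact set of nearly step functions\<close>

lemma convergent_in_compact:
  fixes Y :: "'i \<Rightarrow> 'b::metric_space"
  assumes C: "compact C" and F: "F \<noteq> bot" and ev: "\<forall>\<^sub>F r in F. Y r \<in> C"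
    and small: "\<And>e. 0 < e \<Longrightarrow> \<exists>P. eventually P F \<and> (\<forall>r s. P r \<longrightarrow> P s \<longrightarrow> dist (Y r) (Y s) < e)"
  shows "\<exists>l\<in>C. (Y \<longlongrightarrow> l) F"
proof -
  have "Topological_Spaces.complete C" using C by (rule compact_imp_complete)
  moreover have "filtermap Y F \<le> principal C" using ev by (simp add: le_principal eventually_filtermap)
  moreover have "filtermap Y F \<noteq> bot" using F by (simp add: filtermap_bot_iff)
  moreover have "cauchy_filter (filtermap Y F)"
    unfolding cauchy_filter_metric_filtermap using small by metis
  ultimately show ?thesis unfolding complete_uniform filterlim_def by blast
qed

text \<open>The limit path is the right limit of the limit values \<open>Y\<close> at rational times.  These limits exist
  because \<open>Y\<close> oscillates by at most \<open>1 / (j + 1)\<close> on each piece of the limit partition \<open>t j\<close>,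
  for every \<open>j\<close>, and the same bounds pass to the limit path and give its left limits.  For the
  convergence, fix \<open>j\<close>: after the piecewise linear time change from \<open>\<tau> n j\<close> to \<open>t j\<close>, both paths are
  nearly constant on corresponding pieces, so they are compared at one rational time per piece,
  and only finitely many pieces start before the horizon.\<close>

lemma nearly_step_limit:
  fixes f :: "nat \<Rightarrow> real \<Rightarrow> 'b::metric_space"
  assumes C: "compact C" "C \<subseteq> S" and \<delta>: "\<And>j. 0 < \<delta> j"
    and f: "\<And>n. f n \<in> skorohod_space S" "\<And>n s. 0 \<le> s \<Longrightarrow> f n s \<in> C"
    and \<tau>: "\<And>n j. \<tau> n j \<in> sparse_partitions (real j) (\<delta> j)"
      "\<And>n j. osc_le (real j) (1 / Suc j) UNIV (\<tau> n j) (f n)"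
    and t: "\<And>j. t j \<in> sparse_partitions (real j) (\<delta> j)"
    and \<tau>_lim: "\<And>j. (\<lambda>n. \<tau> n j) \<longlonglongrightarrow> t j"
    and f_lim: "\<And>r. r \<in> \<rat> \<Longrightarrow> 0 \<le> r \<Longrightarrow> (\<lambda>n. f n r) \<longlonglongrightarrow> Y r"
  obtains x where "x \<in> skorohod_space S" "\<And>s. 0 \<le> s \<Longrightarrow> x s \<in> C"
    "\<And>j. osc_le (real j) (1 / Suc j) UNIV (t j) x"
    "\<And>T e. 0 < e \<Longrightarrow> \<forall>\<^sub>F n in sequentially. f n \<in> skorohod_nbhd S x T e"
proof -
  have t_nonneg: "0 \<le> t j i" for j i
    using sparse_partition_mono[OF t \<delta>, of 0 i j] sparse_partition_0[OF t \<delta>, of j] by simp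
  have Y_C: "Y r \<in> C" if "r \<in> \<rat>" "0 \<le> r" for r
    using f(2)[OF that(2)] closed_sequentially[OF compact_imp_closed[OF C(1)] _ f_lim[OF that]] by blast
  have Y_osc: "dist (Y r) (Y s) \<le> 1 / Suc j"
    if "r \<in> \<rat>" "s \<in> \<rat>" "r \<in> {t j i<..<t j (Suc i)}" "s \<in> {t j i<..<t j (Suc i)}" "r < j" "s < j" for r s i j
  proof (rule tendsto_upperbound)
    show "(\<lambda>n. dist (f n r) (f n s)) \<longlonglongrightarrow> dist (Y r) (Y s)"
      using that t_nonneg[of j i] by (intro tendsto_dist f_lim) auto
    show "\<forall>\<^sub>F n in sequentially. dist (f n r) (f n s) \<le> 1 / Suc j"
      using eventually_in_piece[OF \<tau>_lim that(3)] eventually_in_piece[OF \<tau>_lim that(4)]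
    proof eventually_elim
      case (elim n)
      then show ?case using \<tau>(2)[of j n] that(5,6) unfolding osc_le_def by blast
    qed
  qed simp
  \<comment> \<open>Approach \<open>s\<close> from the right through rational times.\<close>
  define R where "R s = at s within ({s<..} \<inter> \<rat>)" for s :: real
  have R_near: "\<forall>\<^sub>F r in R s. r \<in> \<rat> \<and> s < r \<and> r < u" if "s < u" for s u
    using that unfolding R_def eventually_at_filter
    by (auto intro: eventually_mono[OF order_tendstoD(2)[OF tendsto_ident_at]]
        simp: eventually_nhds_metric dist_real_def intro!: exI[of _ "u - s"])
  have R_ne: "R s \<noteq> bot" for s
  proof
    assume "R s = bot"
    have "\<forall>\<^sub>F r in at_right s. r \<notin> \<rat>"
      using \<open>R s = bot\<close> unfolding R_def trivial_limit_def eventually_at_filter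
      by (auto elim: eventually_mono)
    then obtain b where "s < b" "\<And>r. s < r \<Longrightarrow> r < b \<Longrightarrow> r \<notin> \<rat>"
      unfolding eventually_at_right_field by blast
    then show False using Rats_dense_in_real by metis
  qed
  define J where "J s e = (SOME j. s < real j \<and> 1 / Suc j < e)" for s e :: real
  have J: "s < real (J s e) \<and> 1 / Suc (J s e) < e" if "0 < e" for s e :: real
  proof -
    have "\<forall>\<^sub>F n in sequentially. s < real n \<and> 1 / real (Suc n) < e"
    proof (rule eventually_conj)
      show "\<forall>\<^sub>F n in sequentially. s < real n"
        using filterlim_real_sequentially by (simp add: filterlim_at_top_dense)
      show "\<forall>\<^sub>F n in sequentially. 1 / real (Suc n) < e"
        using LIMSEQ_inverse_real_of_nat that
        by (intro order_tendstoD(2)[where y = 0]) (simp_all add: inverse_eq_divide)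
    qed
    then have "\<exists>j. s < real j \<and> 1 / Suc j < e" by (auto dest!: eventually_happens)
    then show ?thesis unfolding J_def by (rule someI_ex)
  qed
  have "\<exists>l\<in>C. (Y \<longlongrightarrow> l) (R s)" if s: "0 \<le> s" for s
  proof (rule convergent_in_compact[OF C(1) R_ne])
    show "\<forall>\<^sub>F r in R s. Y r \<in> C"
    proof -
      have "\<forall>\<^sub>F r in R s. r \<in> \<rat> \<and> s < r \<and> r < s + 1" by (rule R_near) simp
      then show ?thesis by eventually_elim (use s in \<open>auto intro!: Y_C\<close>)
    qed
    fix e :: real assume "0 < e"
    note j = J[OF this, of s]
    obtain i where i: "s \<in> {t (J s e) i..<t (J s e) (Suc i)}"
      using sparse_partition_piece[OF t \<delta> s] by blast
    show "\<exists>P. eventually P (R s) \<and> (\<forall>r u. P r \<longrightarrow> P u \<longrightarrow> dist (Y r) (Y u) < e)"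
    proof (intro exI conjI allI impI)
      show "\<forall>\<^sub>F r in R s. r \<in> \<rat> \<and> s < r \<and> r < min (t (J s e) (Suc i)) (J s e)"
        using i j by (intro R_near) simp
      fix r u
      assume r: "r \<in> \<rat> \<and> s < r \<and> r < min (t (J s e) (Suc i)) (J s e)"
        and u: "u \<in> \<rat> \<and> s < u \<and> u < min (t (J s e) (Suc i)) (J s e)"
      have "dist (Y r) (Y u) \<le> 1 / Suc (J s e)" using r u i by (intro Y_osc[where i = i]) auto
      then show "dist (Y r) (Y u) < e" using j by simp
    qed
  qed
  then obtain x0 where x0: "\<And>s. 0 \<le> s \<Longrightarrow> x0 s \<in> C" "\<And>s. 0 \<le> s \<Longrightarrow> (Y \<longlongrightarrow> x0 s) (R s)"
    by metis
  define x where "x = restrict x0 {0..}"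
  have x: "x s \<in> C" "(Y \<longlongrightarrow> x s) (R s)" if "0 \<le> s" for s
    using x0 that by (auto simp: x_def)
  have xY: "dist (x s) (Y r) \<le> 1 / Suc j"
    if "s \<in> {t j i..<t j (Suc i)}" "s < j" "r \<in> \<rat>" "r \<in> {t j i<..<t j (Suc i)}" "r < j" for s r i j
  proof (rule tendsto_upperbound[OF _ _ R_ne])
    show "((\<lambda>u. dist (Y u) (Y r)) \<longlongrightarrow> dist (x s) (Y r)) (R s)"
      using that t_nonneg[of j i] by (intro tendsto_dist x) auto
    have "s < min (t j (Suc i)) j" using that by simp
    from R_near[OF this] show "\<forall>\<^sub>F u in R s. dist (Y u) (Y r) \<le> 1 / Suc j"
    proof eventually_elim
      case (elim u)
      then show ?case using that by (intro Y_osc[where i = i]) auto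
    qed
  qed
  have x_osc: "dist (x s) (x u) \<le> 1 / Suc j"
    if "s \<in> {t j i..<t j (Suc i)}" "s < j" "u \<in> {t j i..<t j (Suc i)}" "u < j" for s u i j
  proof (rule tendsto_upperbound[OF _ _ R_ne])
    show "((\<lambda>r. dist (x s) (Y r)) \<longlongrightarrow> dist (x s) (x u)) (R u)"
      using that t_nonneg[of j i] by (intro tendsto_dist x) auto
    have "u < min (t j (Suc i)) j" using that by simp
    from R_near[OF this] show "\<forall>\<^sub>F r in R u. dist (x s) (Y r) \<le> 1 / Suc j"
    proof eventually_elim
      case (elim r)
      then show ?case using that by (intro xY[where i = i]) auto
    qed
  qed
  have osc: "osc_le (real j) (1 / Suc j) UNIV (t j) x" for j
    unfolding osc_le_def using x_osc by blast
  have "cadlag S x"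
    unfolding cadlag_def
  proof (intro conjI allI impI)
    fix s :: real assume s: "0 \<le> s"
    then show "x s \<in> S" using x(1) C(2) by blast
    show "(x \<longlongrightarrow> x s) (at_right s)"
    proof (rule tendstoI)
      fix e :: real assume "0 < e"
      note j = J[OF this, of s]
      obtain i where i: "s \<in> {t (J s e) i..<t (J s e) (Suc i)}"
        using sparse_partition_piece[OF t \<delta> s] by blast
      have "s < min (t (J s e) (Suc i)) (J s e)" using i j by simp
      then have "\<forall>\<^sub>F u in at_right s. s < u \<and> u < min (t (J s e) (Suc i)) (J s e)"
        unfolding eventually_at_right_field by blast
      then show "\<forall>\<^sub>F u in at_right s. dist (x u) (x s) < e"
      proof eventually_elim
        case (elim u)
        then have "dist (x u) (x s) \<le> 1 / Suc (J s e)" using i j by (intro x_osc[where i = i]) auto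
        then show ?case using j by simp
      qed
    qed
  next
    fix s :: real assume s: "0 < s"
    have "\<exists>l\<in>C. (x \<longlongrightarrow> l) (at_left s)"
    proof (rule convergent_in_compact[OF C(1)])
      show "at_left s \<noteq> bot" by simp
      have "\<forall>\<^sub>F u in at_left s. 0 < u \<and> u < s" using s by (auto simp: eventually_at_left_field)
      then show "\<forall>\<^sub>F u in at_left s. x u \<in> C" by eventually_elim (simp add: x)
      fix e :: real assume "0 < e"
      note j = J[OF this, of s]
      obtain i where i: "s \<in> {t (J s e) i<..t (J s e) (Suc i)}"
        using sparse_partition_left_piece[OF t \<delta> s] by blast
      show "\<exists>P. eventually P (at_left s) \<and> (\<forall>r u. P r \<longrightarrow> P u \<longrightarrow> dist (x r) (x u) < e)"
      proof (intro exI conjI allI impI)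
        show "\<forall>\<^sub>F r in at_left s. t (J s e) i < r \<and> r < s"
          using i by (auto simp: eventually_at_left_field)
        fix r u assume r: "t (J s e) i < r \<and> r < s" and u: "t (J s e) i < u \<and> u < s"
        have "dist (x r) (x u) \<le> 1 / Suc (J s e)"
          using r u i j by (intro x_osc[where i = i]) auto
        then show "dist (x r) (x u) < e" using j by simp
      qed
    qed
    then show "\<exists>l\<in>S. (x \<longlongrightarrow> l) (at_left s)" using C(2) by blast
  qed
  then have x_sk: "x \<in> skorohod_space S" by (simp add: skorohod_space_def x_def)
  have conv: "\<forall>\<^sub>F n in sequentially. f n \<in> skorohod_nbhd S x T e" if e: "0 < e" for T e
  proof -
    define j where "j = J (T + 1) (min (e / 4) 1)"
    have j: "T + 1 < j" "1 / Suc j < e / 4" using J[of "min (e / 4) 1" "T + 1"] e by (auto simp: j_def)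
    define I where "I = nat \<lceil>T / \<delta> j\<rceil>"
    \<comment> \<open>The bound \<open>1\<close> keeps the deformed times below the horizon \<open>j > T + 1\<close>.\<close>
    define d where "d = min e 1"
    have "\<exists>r. t j i < j \<longrightarrow> r \<in> \<rat> \<and> t j i < r \<and> r < min (t j (Suc i)) j" for i
      using Rats_dense_in_real[of "t j i" "min (t j (Suc i)) j"] sparse_partition_Suc[OF t \<delta>, of j i]
      by auto
    then obtain r where r: "\<And>i. t j i < j \<Longrightarrow> r i \<in> \<rat> \<and> t j i < r i \<and> r i < min (t j (Suc i)) j"
      by metis
    have "\<forall>\<^sub>F n in sequentially. \<bar>t j i - \<tau> n j i\<bar> < d" for i
      using tendstoD[OF tendsto_coordinate[OF \<tau>_lim[of j]], of d i] e
      by (simp add: d_def dist_real_def abs_minus_commute)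
    moreover have "\<forall>\<^sub>F n in sequentially.
      t j i < j \<longrightarrow> r i \<in> {\<tau> n j i..<\<tau> n j (Suc i)} \<and> dist (f n (r i)) (Y (r i)) < e / 4" for i
    proof (cases "t j i < j")
      case True
      note ri = r[OF this]
      have "\<forall>\<^sub>F n in sequentially. r i \<in> {\<tau> n j i..<\<tau> n j (Suc i)}"
        using ri by (intro eventually_in_piece[OF \<tau>_lim]) auto
      moreover have "\<forall>\<^sub>F n in sequentially. dist (f n (r i)) (Y (r i)) < e / 4"
        using ri t_nonneg[of j i] e by (intro tendstoD[OF f_lim]) auto
      ultimately show ?thesis by eventually_elim simp
    qed simp
    ultimately have "\<forall>\<^sub>F n in sequentially. \<forall>i\<in>{..Suc I}. \<bar>t j i - \<tau> n j i\<bar> < d \<and>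
      (t j i < j \<longrightarrow> r i \<in> {\<tau> n j i..<\<tau> n j (Suc i)} \<and> dist (f n (r i)) (Y (r i)) < e / 4)"
      by (intro eventually_ball_finite) (auto intro: eventually_conj)
    then show ?thesis
    proof eventually_elim
      case (elim n)
      obtain \<theta> where \<theta>: "time_change \<theta>"
        "\<And>i s. s \<in> {\<tau> n j i..<\<tau> n j (Suc i)} \<Longrightarrow> \<theta> s \<in> {t j i..<t j (Suc i)}"
        "\<And>i s. s \<in> {\<tau> n j i..<\<tau> n j (Suc i)} \<Longrightarrow>
          \<bar>\<theta> s - s\<bar> \<le> max \<bar>t j i - \<tau> n j i\<bar> \<bar>t j (Suc i) - \<tau> n j (Suc i)\<bar>"
        using piecewise_linear_time_change[OF \<tau>(1) t \<delta>] by blast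
      have "\<bar>\<theta> s - s\<bar> < e \<and> dist (f n s) (x (\<theta> s)) < e" if s: "s \<in> {0..T}" for s
      proof -
        obtain i where i: "s \<in> {\<tau> n j i..<\<tau> n j (Suc i)}"
          using sparse_partition_piece[OF \<tau>(1)[of n j] \<delta>, of s] s by auto
        have "real i * \<delta> j \<le> T"
          using sparse_partition_ge[OF \<tau>(1)[of n j], of i] i s by auto
        then have "real i \<le> T / \<delta> j" using \<delta>[of j] by (simp add: pos_le_divide_eq)
        also have "\<dots> \<le> real I" unfolding I_def by (rule real_nat_ceiling_ge)
        finally have "i \<le> I" by simp
        with elim have el: "\<bar>t j i - \<tau> n j i\<bar> < d" "\<bar>t j (Suc i) - \<tau> n j (Suc i)\<bar> < d"
          "t j i < j \<Longrightarrow> r i \<in> {\<tau> n j i..<\<tau> n j (Suc i)} \<and> dist (f n (r i)) (Y (r i)) < e / 4"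
          by auto
        have near: "\<bar>\<theta> s - s\<bar> < d" using \<theta>(3)[OF i] el(1,2) by simp
        have "t j i < j" using el(1) i s j(1) by (auto simp: d_def)
        note ri = r[OF this] and el3 = el(3)[OF this]
        have "dist (f n s) (f n (r i)) \<le> 1 / Suc j"
          using \<tau>(2)[of j n] i el3 ri s j(1) unfolding osc_le_def by auto
        moreover have "dist (x (\<theta> s)) (Y (r i)) \<le> 1 / Suc j"
          using \<theta>(2)[OF i] near s j(1) ri by (intro xY[where i = i]) (auto simp: d_def)
        moreover have "dist (f n s) (x (\<theta> s)) \<le>
            dist (f n s) (f n (r i)) + (dist (f n (r i)) (Y (r i)) + dist (x (\<theta> s)) (Y (r i)))"
          using dist_triangle[of "f n s" "x (\<theta> s)" "f n (r i)"]
            dist_triangle2[of "f n (r i)" "x (\<theta> s)" "Y (r i)"] by simp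
        ultimately show ?thesis using el3 j(2) near by (auto simp: d_def)
      qed
      then show "f n \<in> skorohod_nbhd S x T e"
        using \<theta>(1) f(1) unfolding skorohod_nbhd_def by blast
    qed
  qed
  show ?thesis by (rule that[OF x_sk x(1) osc conv])
qed

text \<open>The sufficient half of the Arzela-Ascoli theorem for \<open>J1\<close>.  Taking the limit path in the set itself
  makes the set closed, so that it is compact and not just relatively compact.\<close>

theorem compactin_skorohod_J1_nearly_step:
  fixes C S :: "'b::metric_space set"
  assumes C: "compact C" "C \<subseteq> S" and \<delta>: "\<And>j. 0 < \<delta> j"
  shows "compactin (skorohod_J1 S)
    {x \<in> skorohod_space S. (\<forall>s\<ge>0. x s \<in> C) \<and> (\<forall>j. nearly_step (real j) (\<delta> j) (1 / Suc j) x)}"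
    (is "compactin _ ?K")
proof (rule compactin_skorohod_J1I)
  show "?K \<subseteq> skorohod_space S" by blast
  fix f :: "nat \<Rightarrow> real \<Rightarrow> 'b" assume "\<And>n. f n \<in> ?K"
  then have f: "f n \<in> skorohod_space S" "0 \<le> s \<Longrightarrow> f n s \<in> C"
    "nearly_step (real j) (\<delta> j) (1 / Suc j) (f n)" for n s j
    by auto
  define \<tau> where "\<tau> n j =
    (SOME t. t \<in> sparse_partitions (real j) (\<delta> j) \<and> osc_le (real j) (1 / Suc j) UNIV t (f n))" for n j
  have \<tau>: "\<tau> n j \<in> sparse_partitions (real j) (\<delta> j)"
    "osc_le (real j) (1 / Suc j) UNIV (\<tau> n j) (f n)" for n j
    using someI_ex[OF f(3)[of j n, unfolded nearly_step_def Bex_def]] by (simp_all add: \<tau>_def)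
  \<comment> \<open>The absolute value extends the sampling at rational times to all of \<^typ>\<open>rat\<close>; all partitions
    and all samples are extracted at once from a compact product.\<close>
  define g where "g n = (\<tau> n, \<lambda>q::rat. f n \<bar>of_rat q\<bar>)" for n
  let ?G = "{t. \<forall>j. t j \<in> sparse_partitions (real j) (\<delta> j)} \<times> {y :: rat \<Rightarrow> 'b. \<forall>q. y q \<in> C}"
  have G: "compact ?G"
    using C(1) by (intro compact_Times compact_functions compact_sparse_partitions)
  have "\<forall>n. g n \<in> ?G" using \<tau>(1) f(2) by (simp add: g_def)
  then obtain l r where l: "l \<in> ?G" and r: "strict_mono r" "(g \<circ> r) \<longlonglongrightarrow> l"
    by (rule seq_compactE[OF compact_imp_seq_compact[OF G]])
  obtain t y where ty: "l = (t, y)" by (cases l)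
  have \<tau>_lim: "(\<lambda>n. \<tau> (r n)) \<longlonglongrightarrow> t" and f_lim: "(\<lambda>n q. f (r n) \<bar>of_rat q\<bar>) \<longlonglongrightarrow> y"
    using tendsto_fst[OF r(2)] tendsto_snd[OF r(2)] by (simp_all add: g_def ty o_def)
  define Y where "Y s = lim (\<lambda>n. f (r n) s)" for s
  have Y: "(\<lambda>n. f (r n) s) \<longlonglongrightarrow> Y s" if s: "s \<in> \<rat>" "0 \<le> s" for s
  proof -
    obtain q where "s = of_rat q" using s(1) by (auto elim: Rats_cases)
    then have "(\<lambda>n. f (r n) s) \<longlonglongrightarrow> y q" using tendsto_coordinate[OF f_lim, of q] s(2) by simp
    then show ?thesis unfolding Y_def by (simp add: limI)
  qed
  obtain x where x: "x \<in> skorohod_space S" "\<And>s. 0 \<le> s \<Longrightarrow> x s \<in> C"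
    "\<And>j. osc_le (real j) (1 / Suc j) UNIV (t j) x"
    "\<And>T e. 0 < e \<Longrightarrow> \<forall>\<^sub>F n in sequentially. f (r n) \<in> skorohod_nbhd S x T e"
    by (rule nearly_step_limit[of C S \<delta> "\<lambda>n. f (r n)" "\<lambda>n. \<tau> (r n)" t Y])
      (use C \<delta> f \<tau> Y l ty tendsto_coordinate[OF \<tau>_lim] in auto)
  have "nearly_step (real j) (\<delta> j) (1 / Suc j) x" for j
    using x(3)[of j] l ty unfolding nearly_step_def by blast
  then have "x \<in> ?K" using x(1,2) by simp
  then show "\<exists>x\<in>?K. \<exists>r. strict_mono r \<and>
      (\<forall>T e. 0 < e \<longrightarrow> (\<forall>\<^sub>F n in sequentially. f (r n) \<in> skorohod_nbhd S x T e))"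
    using r(1) x(4) by blast
qed

section \<open>Decreasing processes and the gaps between their drops\<close>

text \<open>Progressive measurability of right-continuous adapted processes, at a stopping time: approximate
  the stopped time from the right by times with values in a grid, capped at \<open>t\<close> so that the values
  of the process stay measurable at time \<open>t\<close>.\<close>

lemma right_continuous_stopped_measurable:
  fixes Y :: "real \<Rightarrow> 'a \<Rightarrow> 'b::metric_space"
  assumes "filtration \<Omega> F" and \<sigma>: "stopping_time F \<sigma>" "\<And>\<omega>. \<omega> \<in> \<Omega> \<Longrightarrow> 0 \<le> \<sigma> \<omega>" and t: "0 \<le> t"
    and adapted: "\<And>s. 0 \<le> s \<Longrightarrow> Y s \<in> borel_measurable (F s)"
    and rc: "\<And>\<omega> s. \<omega> \<in> \<Omega> \<Longrightarrow> 0 \<le> s \<Longrightarrow> ((\<lambda>s. Y s \<omega>) \<longlongrightarrow> Y s \<omega>) (at_right s)"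
  shows "(\<lambda>\<omega>. Y (min (\<sigma> \<omega>) t) \<omega>) \<in> borel_measurable (F t)"
proof -
  interpret filtration \<Omega> F by fact
  define \<tau> where "\<tau> \<omega> = min (\<sigma> \<omega>) t" for \<omega>
  have \<tau>[measurable]: "\<tau> \<in> borel_measurable (F t)"
  proof (rule borel_measurableI_le)
    fix a
    show "{\<omega> \<in> space (F t). \<tau> \<omega> \<le> a} \<in> sets (F t)"
    proof (cases "t \<le> a")
      case False
      then have "{\<omega> \<in> space (F t). \<tau> \<omega> \<le> a} = {\<omega> \<in> space (F t). \<sigma> \<omega> \<le> a}"
        by (auto simp: \<tau>_def)
      then show ?thesis
        using stopping_time_le_const[OF \<sigma>(1), of a t] False by (simp add: pred_def)
    next
      case True
      then have "{\<omega> \<in> space (F t). \<tau> \<omega> \<le> a} = space (F t)" by (auto simp: \<tau>_def)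
      then show ?thesis by simp
    qed
  qed
  have Y_t: "Y s \<in> borel_measurable (F t)" if "0 \<le> s" "s \<le> t" for s
    using adapted[OF that(1)] sets_F_mono[OF that(2)] unfolding measurable_def by (auto simp: space_F)
  define k where "k n \<omega> = \<lfloor>\<tau> \<omega> * real (Suc n)\<rfloor>" for n \<omega>
  define u where "u n i = min (real_of_int (max i 0 + 1) / real (Suc n)) t" for n i
  show ?thesis
    unfolding \<tau>_def[symmetric]
  proof (rule borel_measurable_LIMSEQ_metric)
    fix n
    have [measurable]: "k n \<in> F t \<rightarrow>\<^sub>M count_space UNIV" unfolding k_def by measurable
    have "Y (u n i) \<in> borel_measurable (F t)" for i
      using t by (intro Y_t) (auto simp: u_def)
    then show "(\<lambda>\<omega>. Y (u n (k n \<omega>)) \<omega>) \<in> borel_measurable (F t)"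
      by (rule measurable_compose_countable) measurable
  next
    fix \<omega> assume "\<omega> \<in> space (F t)"
    then have \<omega>: "\<omega> \<in> \<Omega>" by (simp add: space_F)
    have \<tau>0: "0 \<le> \<tau> \<omega>" "\<tau> \<omega> \<le> t" using \<sigma>(2)[OF \<omega>] t by (auto simp: \<tau>_def)
    have u: "\<tau> \<omega> \<le> u n (k n \<omega>)" "u n (k n \<omega>) \<le> \<tau> \<omega> + 1 / real (Suc n)" for n
    proof -
      have "0 \<le> k n \<omega>" using \<tau>0 by (simp add: k_def)
      moreover have "real_of_int (k n \<omega>) \<le> \<tau> \<omega> * real (Suc n)"
        "\<tau> \<omega> * real (Suc n) < real_of_int (k n \<omega>) + 1"
        unfolding k_def by linarith+
      ultimately have k: "0 \<le> k n \<omega>" "real_of_int (k n \<omega>) / real (Suc n) \<le> \<tau> \<omega>"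
        "\<tau> \<omega> \<le> (real_of_int (k n \<omega>) + 1) / real (Suc n)"
        by (simp_all only: pos_divide_le_eq pos_le_divide_eq of_nat_0_less_iff zero_less_Suc less_imp_le)
      then show "\<tau> \<omega> \<le> u n (k n \<omega>)" using \<tau>0 by (simp add: u_def)
      have "u n (k n \<omega>) \<le> real_of_int (k n \<omega>) / real (Suc n) + 1 / real (Suc n)"
        using k(1) by (simp add: u_def add_divide_distrib)
      then show "u n (k n \<omega>) \<le> \<tau> \<omega> + 1 / real (Suc n)" using k(2) by linarith
    qed
    have "(\<lambda>n. \<tau> \<omega> + 1 / real (Suc n)) \<longlonglongrightarrow> \<tau> \<omega> + 0"
      using LIMSEQ_inverse_real_of_nat by (intro tendsto_intros) (simp add: inverse_eq_divide)
    then have up: "(\<lambda>n. \<tau> \<omega> + 1 / real (Suc n)) \<longlonglongrightarrow> \<tau> \<omega>" by simp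
    have lim: "(\<lambda>n. u n (k n \<omega>)) \<longlonglongrightarrow> \<tau> \<omega>"
    proof (rule tendsto_sandwich[OF _ _ tendsto_const up])
      show "\<forall>\<^sub>F n in sequentially. \<tau> \<omega> \<le> u n (k n \<omega>)" by (rule always_eventually) (rule allI u(1))+
      show "\<forall>\<^sub>F n in sequentially. u n (k n \<omega>) \<le> \<tau> \<omega> + 1 / real (Suc n)"
        by (rule always_eventually) (rule allI u(2))+
    qed
    have cont: "continuous (at (\<tau> \<omega>) within {\<tau> \<omega>..}) (\<lambda>s. Y s \<omega>)"
      using rc[OF \<omega> \<tau>0(1)] by (simp add: continuous_within at_within_Ici_at_right)
    show "(\<lambda>n. Y (u n (k n \<omega>)) \<omega>) \<longlonglongrightarrow> Y (\<tau> \<omega>) \<omega>"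
      by (rule continuous_within_tendsto_compose'[OF cont _ lim]) (simp add: u(1))
  qed
qed

lemma right_continuous_random_time_measurable:
  fixes Y :: "real \<Rightarrow> 'a \<Rightarrow> 'b::metric_space"
  assumes \<sigma>: "\<sigma> \<in> borel_measurable M" "\<And>\<omega>. \<omega> \<in> space M \<Longrightarrow> 0 \<le> \<sigma> \<omega> \<and> \<sigma> \<omega> \<le> c"
    and Y: "\<And>s. 0 \<le> s \<Longrightarrow> Y s \<in> borel_measurable M"
    and rc: "\<And>\<omega> s. \<omega> \<in> space M \<Longrightarrow> 0 \<le> s \<Longrightarrow> ((\<lambda>s. Y s \<omega>) \<longlongrightarrow> Y s \<omega>) (at_right s)"
  shows "(\<lambda>\<omega>. Y (\<sigma> \<omega>) \<omega>) \<in> borel_measurable M"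
proof -
  have "filtration (space M) (\<lambda>_::real. M)" by unfold_locales auto
  moreover have "stopping_time (\<lambda>_. M) \<sigma>" using \<sigma>(1) by (intro stopping_timeI) measurable
  ultimately have "(\<lambda>\<omega>. Y (min (\<sigma> \<omega>) (max 0 c)) \<omega>) \<in> borel_measurable M"
    by (rule right_continuous_stopped_measurable) (simp_all add: \<sigma>(2) Y rc)
  moreover have "(\<lambda>\<omega>. Y (min (\<sigma> \<omega>) (max 0 c)) \<omega>) \<in> borel_measurable M \<longleftrightarrow>
      (\<lambda>\<omega>. Y (\<sigma> \<omega>) \<omega>) \<in> borel_measurable M"
  proof (rule measurable_cong)
    fix \<omega> assume "\<omega> \<in> space M"
    then have "\<sigma> \<omega> \<le> max 0 c" using \<sigma>(2) by fastforce
    then show "Y (min (\<sigma> \<omega>) (max 0 c)) \<omega> = Y (\<sigma> \<omega>) \<omega>" by (simp add: min_absorb1)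
  qed
  ultimately show ?thesis by simp
qed

text \<open>The filtration satisfies no completeness or right-continuity conditions, as is the case for the
  natural filtration of a process.\<close>

locale decreasing_process = prob_space M + filtration "space M" F
  for M :: "'a measure" and F :: "real \<Rightarrow> 'a measure" +
  fixes q :: "real \<Rightarrow> 'a \<Rightarrow> real"
  assumes sets_F_M: "\<And>t. sets (F t) \<subseteq> sets M"
    and adapted: "\<And>t. 0 \<le> t \<Longrightarrow> q t \<in> borel_measurable (F t)"
    and right_cont: "\<And>\<omega> t. \<omega> \<in> space M \<Longrightarrow> 0 \<le> t \<Longrightarrow> ((\<lambda>s. q s \<omega>) \<longlongrightarrow> q t \<omega>) (at_right t)"
    and decreasing: "\<And>\<omega> s t. \<omega> \<in> space M \<Longrightarrow> 0 \<le> s \<Longrightarrow> s \<le> t \<Longrightarrow> q t \<omega> \<le> q s \<omega>"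
    and nonneg: "\<And>\<omega> t. \<omega> \<in> space M \<Longrightarrow> 0 \<le> t \<Longrightarrow> 0 \<le> q t \<omega>"
begin

text \<open>The successive times at which the process has lost another \<open>\<epsilon>\<close>, stopped at \<open>T\<close>.\<close>

primrec drop_time :: "real \<Rightarrow> real \<Rightarrow> nat \<Rightarrow> 'a \<Rightarrow> real" where
  "drop_time \<epsilon> T 0 \<omega> = 0"
| "drop_time \<epsilon> T (Suc k) \<omega> =
     Inf (insert T {s. 0 \<le> s \<and> q s \<omega> \<le> q (drop_time \<epsilon> T k \<omega>) \<omega> - \<epsilon>})"

definition short_gap_at :: "real \<Rightarrow> real \<Rightarrow> real \<Rightarrow> nat \<Rightarrow> 'a set" where
  "short_gap_at \<epsilon> T \<delta> k = {\<omega> \<in> space M. drop_time \<epsilon> T (Suc k) \<omega> < T \<and>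
     drop_time \<epsilon> T (Suc k) \<omega> - drop_time \<epsilon> T k \<omega> \<le> \<delta>}"

definition short_gap :: "real \<Rightarrow> real \<Rightarrow> real \<Rightarrow> 'a set" where
  "short_gap \<epsilon> T \<delta> = (\<Union>k. short_gap_at \<epsilon> T \<delta> k)"

context
  fixes \<epsilon> T :: real
  assumes \<epsilon>: "0 < \<epsilon>" and T: "0 < T"
begin

lemma drop_time_bounds: "0 \<le> drop_time \<epsilon> T k \<omega>" "drop_time \<epsilon> T k \<omega> \<le> T"
proof -
  have bounds: "0 \<le> Inf (insert T {s. 0 \<le> s \<and> q s \<omega> \<le> c})" "Inf (insert T {s. 0 \<le> s \<and> q s \<omega> \<le> c}) \<le> T" for c
  proof -
    show "0 \<le> Inf (insert T {s. 0 \<le> s \<and> q s \<omega> \<le> c})" using T by (intro cInf_greatest) auto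
    show "Inf (insert T {s. 0 \<le> s \<and> q s \<omega> \<le> c}) \<le> T"
      using T by (intro cInf_lower bdd_belowI[of _ 0]) auto
  qed
  show "0 \<le> drop_time \<epsilon> T k \<omega>" "drop_time \<epsilon> T k \<omega> \<le> T"
    using T bounds by (cases k; simp)+
qed

text \<open>The infimum is attained: beyond it the process lies below the threshold by monotonicity, and right
  continuity extends this to the infimum itself.  This is what makes the drop times stopping times
  for a filtration that need not be right-continuous.\<close>

lemma drop_time_Suc_le_iff:
  assumes \<omega>: "\<omega> \<in> space M" and t: "0 \<le> t" "t < T"
  shows "drop_time \<epsilon> T (Suc k) \<omega> \<le> t \<longleftrightarrow> q t \<omega> \<le> q (drop_time \<epsilon> T k \<omega>) \<omega> - \<epsilon>"
proof
  let ?c = "q (drop_time \<epsilon> T k \<omega>) \<omega> - \<epsilon>" and ?A = "{s. 0 \<le> s \<and> q s \<omega> \<le> q (drop_time \<epsilon> T k \<omega>) \<omega> - \<epsilon>}"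
  have bdd: "bdd_below (insert T ?A)" using T by (intro bdd_belowI[of _ 0]) auto
  show "drop_time \<epsilon> T (Suc k) \<omega> \<le> t" if "q t \<omega> \<le> ?c"
    using that t bdd by (auto intro!: cInf_lower)
  assume le: "drop_time \<epsilon> T (Suc k) \<omega> \<le> t"
  have after: "q s \<omega> \<le> ?c" if "t < s" "s < T" for s
  proof -
    have "Inf (insert T ?A) < s" using le that by simp
    then obtain a where "a \<in> insert T ?A" "a < s" using cInf_lessD[of "insert T ?A"] by auto
    then show ?thesis using that decreasing[OF \<omega>, of a s] by auto
  qed
  show "q t \<omega> \<le> ?c"
  proof (rule tendsto_upperbound[OF right_cont[OF \<omega> t(1)]])
    show "\<forall>\<^sub>F s in at_right t. q s \<omega> \<le> ?c"
      unfolding eventually_at_right_field using after t by blast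
  qed simp
qed

lemma q_drop_time_Suc:
  assumes \<omega>: "\<omega> \<in> space M" and "drop_time \<epsilon> T (Suc k) \<omega> < T"
  shows "q (drop_time \<epsilon> T (Suc k) \<omega>) \<omega> \<le> q (drop_time \<epsilon> T k \<omega>) \<omega> - \<epsilon>"
  using drop_time_Suc_le_iff[OF \<omega> drop_time_bounds(1) assms(2), of k] by simp

lemma drop_time_mono_Suc:
  assumes \<omega>: "\<omega> \<in> space M"
  shows "drop_time \<epsilon> T k \<omega> \<le> drop_time \<epsilon> T (Suc k) \<omega>"
proof (cases "drop_time \<epsilon> T (Suc k) \<omega> < T")
  case True
  show ?thesis
  proof (rule ccontr)
    assume "\<not> ?thesis"
    then have "q (drop_time \<epsilon> T k \<omega>) \<omega> \<le> q (drop_time \<epsilon> T (Suc k) \<omega>) \<omega>"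
      by (intro decreasing[OF \<omega>] drop_time_bounds) simp
    then show False using q_drop_time_Suc[OF \<omega> True] \<epsilon> by simp
  qed
next
  case False
  then show ?thesis using drop_time_bounds(2)[of k \<omega>] by simp
qed

lemma drop_time_mono: "\<omega> \<in> space M \<Longrightarrow> j \<le> k \<Longrightarrow> drop_time \<epsilon> T j \<omega> \<le> drop_time \<epsilon> T k \<omega>"
  by (rule lift_Suc_mono_le[of "\<lambda>k. drop_time \<epsilon> T k \<omega>"]) (rule drop_time_mono_Suc)

text \<open>The condition \<open>q t \<le> q \<sigma>\<^sub>k - \<epsilon>\<close> cannot hold before \<open>\<sigma>\<^sub>k\<close>, so it is unchanged when \<open>\<sigma>\<^sub>k\<close> is
  replaced by \<open>min \<sigma>\<^sub>k t\<close>, and then it only involves the past of \<open>t\<close>.\<close>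

lemma stopping_time_drop_time: "stopping_time F (drop_time \<epsilon> T k)"
proof (induction k)
  case 0
  show ?case by (simp add: stopping_time_const)
next
  case (Suc k)
  show ?case
  proof (rule stopping_timeI)
    fix t
    consider "t < 0" | "T \<le> t" | "0 \<le> t" "t < T" by linarith
    then show "Measurable.pred (F t) (\<lambda>\<omega>. drop_time \<epsilon> T (Suc k) \<omega> \<le> t)"
    proof cases
      case 1
      then have "\<not> drop_time \<epsilon> T (Suc k) \<omega> \<le> t" for \<omega>
        using drop_time_bounds(1)[of "Suc k" \<omega>] by linarith
      then show ?thesis by (simp del: drop_time.simps)
    next
      case 2
      then have "drop_time \<epsilon> T (Suc k) \<omega> \<le> t" for \<omega>
        using drop_time_bounds(2)[of "Suc k" \<omega>] by linarith
      then show ?thesis by (simp del: drop_time.simps)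
    next
      case 3
      have [measurable]: "(\<lambda>\<omega>. q (min (drop_time \<epsilon> T k \<omega>) t) \<omega>) \<in> borel_measurable (F t)"
        by (rule right_continuous_stopped_measurable[OF filtration_axioms Suc.IH
            drop_time_bounds(1) 3(1) adapted right_cont])
      have [measurable]: "q t \<in> borel_measurable (F t)" using 3 by (intro adapted)
      have "drop_time \<epsilon> T (Suc k) \<omega> \<le> t \<longleftrightarrow> q t \<omega> \<le> q (min (drop_time \<epsilon> T k \<omega>) t) \<omega> - \<epsilon>"
        if \<omega>: "\<omega> \<in> space (F t)" for \<omega>
      proof -
        have \<omega>: "\<omega> \<in> space M" using \<omega> by (simp add: space_F)
        have "t \<le> drop_time \<epsilon> T k \<omega> \<Longrightarrow> q (drop_time \<epsilon> T k \<omega>) \<omega> \<le> q t \<omega>"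
          using 3 by (intro decreasing[OF \<omega>])
        then show ?thesis
          unfolding drop_time_Suc_le_iff[OF \<omega> 3] using \<epsilon> by (auto simp: min_def)
      qed
      then have "Measurable.pred (F t) (\<lambda>\<omega>. drop_time \<epsilon> T (Suc k) \<omega> \<le> t) \<longleftrightarrow>
          Measurable.pred (F t) (\<lambda>\<omega>. q t \<omega> \<le> q (min (drop_time \<epsilon> T k \<omega>) t) \<omega> - \<epsilon>)"
        by (rule measurable_cong)
      then show ?thesis by simp
    qed
  qed
qed

lemma drop_time_measurable[measurable]: "drop_time \<epsilon> T k \<in> borel_measurable M"
  by (rule measurable_stopping_time[OF stopping_time_drop_time sets_F_M space_F])

lemma short_gap_at_measurable[measurable]: "short_gap_at \<epsilon> T \<delta> k \<in> events"
  unfolding short_gap_at_def by measurable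

lemma short_gap_measurable[measurable]: "short_gap \<epsilon> T \<delta> \<in> events"
  unfolding short_gap_def by measurable

lemma short_gap_mono: "\<delta> \<le> \<delta>' \<Longrightarrow> short_gap \<epsilon> T \<delta> \<subseteq> short_gap \<epsilon> T \<delta>'"
  unfolding short_gap_def short_gap_at_def by (intro UN_mono) (auto simp del: drop_time.simps)

lemma short_gap_at_subset:
  "short_gap_at \<epsilon> T \<delta> k \<subseteq>
     {\<omega> \<in> space M. \<epsilon> \<le> q (drop_time \<epsilon> T k \<omega>) \<omega> - q (drop_time \<epsilon> T k \<omega> + \<delta>) \<omega>}"
proof
  fix \<omega> assume "\<omega> \<in> short_gap_at \<epsilon> T \<delta> k"
  then have \<omega>: "\<omega> \<in> space M" and gap: "drop_time \<epsilon> T (Suc k) \<omega> < T"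
    "drop_time \<epsilon> T (Suc k) \<omega> \<le> drop_time \<epsilon> T k \<omega> + \<delta>"
    by (auto simp: short_gap_at_def simp del: drop_time.simps)
  have "q (drop_time \<epsilon> T k \<omega> + \<delta>) \<omega> \<le> q (drop_time \<epsilon> T (Suc k) \<omega>) \<omega>"
    by (rule decreasing[OF \<omega> drop_time_bounds(1) gap(2)])
  then show "\<omega> \<in> {\<omega> \<in> space M. \<epsilon> \<le> q (drop_time \<epsilon> T k \<omega>) \<omega> - q (drop_time \<epsilon> T k \<omega> + \<delta>) \<omega>}"
    using q_drop_time_Suc[OF \<omega> gap(1)] \<omega> by simp
qed

text \<open>If the first \<open>N\<close> drops occur before \<open>T\<close>, fewer than \<open>T / \<delta> \<le> N / 2\<close> of the \<open>N\<close> gaps can be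
  longer than \<open>\<delta>\<close>.  Taking expectations of the total gap length on this event \<open>B\<close> yields
  \<open>N \<delta> (P(B) - \<eta>) \<le> T P(B)\<close>.\<close>

lemma prob_many_drops_le:
  assumes \<eta>: "\<And>k. prob (short_gap_at \<epsilon> T \<delta> k) \<le> \<eta>" and N: "2 * T \<le> real N * \<delta>" and \<delta>: "0 < \<delta>"
  shows "prob {\<omega> \<in> space M. drop_time \<epsilon> T N \<omega> < T} \<le> 2 * \<eta>"
proof -
  define B where "B = {\<omega> \<in> space M. drop_time \<epsilon> T N \<omega> < T}"
  have [measurable]: "B \<in> events" unfolding B_def by measurable
  have pointwise: "(\<Sum>k<N. \<delta> * indicator (B - short_gap_at \<epsilon> T \<delta> k) \<omega>) \<le> T * indicator B \<omega>"
    if \<omega>: "\<omega> \<in> space M" for \<omega>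
  proof (cases "\<omega> \<in> B")
    case True
    have "(\<Sum>k<N. \<delta> * indicator (B - short_gap_at \<epsilon> T \<delta> k) \<omega>) \<le>
        (\<Sum>k<N. drop_time \<epsilon> T (Suc k) \<omega> - drop_time \<epsilon> T k \<omega>)"
    proof (intro sum_mono)
      fix k assume "k \<in> {..<N}"
      then have "drop_time \<epsilon> T (Suc k) \<omega> < T"
        using drop_time_mono[OF \<omega>, of "Suc k" N] True by (simp add: B_def del: drop_time.simps)
      then show "\<delta> * indicator (B - short_gap_at \<epsilon> T \<delta> k) \<omega> \<le>
          drop_time \<epsilon> T (Suc k) \<omega> - drop_time \<epsilon> T k \<omega>"
        using drop_time_mono_Suc[OF \<omega>, of k] \<omega>
        by (auto simp: indicator_def short_gap_at_def simp del: drop_time.simps)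
    qed
    also have "\<dots> = drop_time \<epsilon> T N \<omega>"
      by (subst sum_lessThan_telescope[of "\<lambda>k. drop_time \<epsilon> T k \<omega>"]) simp
    also have "\<dots> \<le> T" by (rule drop_time_bounds)
    finally show ?thesis using True by simp
  qed simp
  have "(\<Sum>k<N. \<delta> * prob (B - short_gap_at \<epsilon> T \<delta> k)) =
      (\<integral>\<omega>. (\<Sum>k<N. \<delta> * indicator (B - short_gap_at \<epsilon> T \<delta> k) \<omega>) \<partial>M)"
    by (subst Bochner_Integration.integral_sum) (auto simp: emeasure_eq_measure)
  also have "\<dots> \<le> (\<integral>\<omega>. T * indicator B \<omega> \<partial>M)"
  proof (rule integral_mono)
    show "integrable M (\<lambda>\<omega>. \<Sum>k<N. \<delta> * indicator (B - short_gap_at \<epsilon> T \<delta> k) \<omega>)"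
      by (intro Bochner_Integration.integrable_sum integrable_mult_right integrable_real_indicator)
        (auto simp: emeasure_eq_measure)
    show "integrable M (\<lambda>\<omega>. T * indicator B \<omega>)"
      by (intro integrable_mult_right integrable_real_indicator) (auto simp: emeasure_eq_measure)
  qed (rule pointwise)
  also have "\<dots> = T * prob B" by simp
  finally have le: "(\<Sum>k<N. \<delta> * prob (B - short_gap_at \<epsilon> T \<delta> k)) \<le> T * prob B" .
  have "\<delta> * (prob B - \<eta>) \<le> \<delta> * prob (B - short_gap_at \<epsilon> T \<delta> k)" for k
  proof -
    have "prob B \<le> prob ((B - short_gap_at \<epsilon> T \<delta> k) \<union> short_gap_at \<epsilon> T \<delta> k)"
      by (intro finite_measure_mono) auto
    also have "\<dots> \<le> prob (B - short_gap_at \<epsilon> T \<delta> k) + prob (short_gap_at \<epsilon> T \<delta> k)"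
      by (intro measure_Un_le) auto
    finally show ?thesis using \<eta>[of k] \<delta> by (intro mult_left_mono) auto
  qed
  then have "real N * (\<delta> * (prob B - \<eta>)) \<le> (\<Sum>k<N. \<delta> * prob (B - short_gap_at \<epsilon> T \<delta> k))"
    using sum_mono[of "{..<N}" "\<lambda>_. \<delta> * (prob B - \<eta>)"] by simp
  with le have main: "real N * \<delta> * (prob B - \<eta>) \<le> T * prob B" by (simp add: mult.assoc)
  have "prob B \<le> 2 * \<eta>"
  proof (rule ccontr)
    assume neg: "\<not> prob B \<le> 2 * \<eta>"
    have "0 \<le> \<eta>" using \<eta>[of 0] measure_nonneg[of M] by (rule order_trans[rotated])
    then have "2 * T * (prob B - \<eta>) \<le> real N * \<delta> * (prob B - \<eta>)"
      using N neg by (intro mult_right_mono) auto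
    then have "T * (2 * prob B - 2 * \<eta>) \<le> T * prob B" using main by (simp add: algebra_simps)
    then show False using T neg by simp
  qed
  then show ?thesis by (simp add: B_def)
qed

lemma prob_short_gap_le:
  "prob (short_gap \<epsilon> T \<delta>) \<le>
     prob {\<omega> \<in> space M. drop_time \<epsilon> T N \<omega> < T} + (\<Sum>k<N. prob (short_gap_at \<epsilon> T \<delta> k))"
proof -
  let ?B = "{\<omega> \<in> space M. drop_time \<epsilon> T N \<omega> < T}"
  have "short_gap \<epsilon> T \<delta> \<subseteq> ?B \<union> (\<Union>k<N. short_gap_at \<epsilon> T \<delta> k)"
  proof
    fix \<omega> assume "\<omega> \<in> short_gap \<epsilon> T \<delta>"
    then obtain k where k: "\<omega> \<in> short_gap_at \<epsilon> T \<delta> k" by (auto simp: short_gap_def)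
    show "\<omega> \<in> ?B \<union> (\<Union>k<N. short_gap_at \<epsilon> T \<delta> k)"
    proof (cases "k < N")
      case False
      then have "drop_time \<epsilon> T N \<omega> \<le> drop_time \<epsilon> T (Suc k) \<omega>"
        using k by (intro drop_time_mono) (auto simp: short_gap_at_def)
      then show ?thesis using k by (auto simp: short_gap_at_def simp del: drop_time.simps)
    qed (use k in auto)
  qed
  then have "prob (short_gap \<epsilon> T \<delta>) \<le> prob (?B \<union> (\<Union>k<N. short_gap_at \<epsilon> T \<delta> k))"
    by (intro finite_measure_mono) auto
  also have "\<dots> \<le> prob ?B + prob (\<Union>k<N. short_gap_at \<epsilon> T \<delta> k)"
    by (intro measure_Un_le) auto
  also have "prob (\<Union>k<N. short_gap_at \<epsilon> T \<delta> k) \<le> (\<Sum>k<N. prob (short_gap_at \<epsilon> T \<delta> k))"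
    by (intro measure_UNION_le) auto
  finally show ?thesis by simp
qed

text \<open>A nonnegative path drops by \<open>\<epsilon>\<close> only finitely often, and right continuity makes all gaps positive,
  so the shortest of them is positive.\<close>

lemma ex_not_short_gap:
  assumes \<omega>: "\<omega> \<in> space M"
  shows "\<exists>m. \<omega> \<notin> short_gap \<epsilon> T (1 / Suc m)"
proof -
  let ?\<sigma> = "\<lambda>k. drop_time \<epsilon> T k \<omega>"
  have drop: "?\<sigma> k < T \<Longrightarrow> q (?\<sigma> k) \<omega> \<le> q 0 \<omega> - real k * \<epsilon>" for k
  proof (induction k)
    case (Suc k)
    have "?\<sigma> k < T" using Suc.prems drop_time_mono_Suc[OF \<omega>, of k] by linarith
    then show ?case using Suc.IH q_drop_time_Suc[OF \<omega> Suc.prems]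
      by (simp add: algebra_simps del: drop_time.simps)
  qed simp
  obtain K where K: "q 0 \<omega> < real K * \<epsilon>" using reals_Archimedean3[OF \<epsilon>] by blast
  have few: "k < K" if "?\<sigma> k < T" for k
  proof (rule ccontr)
    assume "\<not> k < K"
    then have "real K * \<epsilon> \<le> real k * \<epsilon>" using \<epsilon> by simp
    then show False
      using drop[OF that] K nonneg[OF \<omega> drop_time_bounds(1)[of k \<omega>]] by linarith
  qed
  have strict: "?\<sigma> k < ?\<sigma> (Suc k)" if "?\<sigma> (Suc k) < T" for k
    using drop_time_mono_Suc[OF \<omega>, of k] q_drop_time_Suc[OF \<omega> that] \<epsilon>
    by (cases "?\<sigma> k = ?\<sigma> (Suc k)") (auto simp del: drop_time.simps)
  let ?D = "insert 1 {?\<sigma> (Suc k) - ?\<sigma> k |k. ?\<sigma> (Suc k) < T}"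
  have "{?\<sigma> (Suc k) - ?\<sigma> k |k. ?\<sigma> (Suc k) < T} \<subseteq> (\<lambda>k. ?\<sigma> (Suc k) - ?\<sigma> k) ` {..<K}"
    using few Suc_lessD by (blast del: notI)
  then have fin: "finite ?D" using finite_subset by blast
  have "0 < Min ?D" using fin strict by (subst Min_gr_iff) (auto simp del: drop_time.simps)
  then obtain m where m: "1 / Suc m < Min ?D" by (rule nat_approx_posE)
  have "\<omega> \<notin> short_gap \<epsilon> T (1 / Suc m)"
  proof
    assume "\<omega> \<in> short_gap \<epsilon> T (1 / Suc m)"
    then obtain k where k: "?\<sigma> (Suc k) < T" "?\<sigma> (Suc k) - ?\<sigma> k \<le> 1 / Suc m"
      by (auto simp: short_gap_def short_gap_at_def simp del: drop_time.simps)
    have "Min ?D \<le> ?\<sigma> (Suc k) - ?\<sigma> k" using fin k(1) by (intro Min_le) auto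
    then show False using k(2) m by linarith
  qed
  then show ?thesis ..
qed

lemma prob_short_gap_small:
  assumes "0 < \<eta>"
  shows "\<exists>\<delta>>0. prob (short_gap \<epsilon> T \<delta>) \<le> \<eta>"
proof -
  let ?A = "\<lambda>m. short_gap \<epsilon> T (1 / Suc m)"
  have "(\<lambda>m. prob (?A m)) \<longlonglongrightarrow> prob (\<Inter>m. ?A m)"
    by (rule finite_Lim_measure_decseq)
      (auto simp: decseq_def intro!: short_gap_mono divide_left_mono)
  also have "(\<Inter>m. ?A m) = {}"
    using ex_not_short_gap sets.sets_into_space[OF short_gap_measurable] by blast
  finally have "\<forall>\<^sub>F m in sequentially. prob (?A m) < \<eta>"
    using assms by (intro order_tendstoD(2)) simp_all
  then obtain m where "prob (?A m) < \<eta>" by (auto dest: eventually_happens)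
  then show ?thesis by (intro exI[of _ "1 / Suc m"]) auto
qed

end

text \<open>The partition consists of the drop times before \<open>T\<close>; from there on it is continued by the
  points \<open>T + i \<delta>\<close>, which keeps all gaps at least \<open>\<delta>\<close>.\<close>

lemma short_gap_free_path:
  assumes \<epsilon>: "0 < \<epsilon>" and T: "0 < T" and \<delta>: "0 < \<delta>"
    and \<omega>: "\<omega> \<in> space M" "\<omega> \<notin> short_gap \<epsilon> T \<delta>"
  obtains t where "t 0 = 0" "\<And>i. t i + \<delta> \<le> t (Suc i)" "\<And>i. t i \<le> T + real i * \<delta>"
    "\<And>i r s. r \<in> {t i..<t (Suc i)} \<Longrightarrow> s \<in> {t i..<t (Suc i)} \<Longrightarrow> r < T \<Longrightarrow> s < T \<Longrightarrow>
      \<bar>q r \<omega> - q s \<omega>\<bar> \<le> \<epsilon>"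
proof -
  define \<sigma> where "\<sigma> k = drop_time \<epsilon> T k \<omega>" for k
  define t where "t i = (if \<sigma> i < T then \<sigma> i else T + real i * \<delta>)" for i
  note bounds = drop_time_bounds[OF \<epsilon> T, of _ \<omega>, folded \<sigma>_def]
  note mono = drop_time_mono_Suc[OF \<epsilon> T \<omega>(1), folded \<sigma>_def]
  have gap: "\<sigma> k + \<delta> \<le> \<sigma> (Suc k)" if "\<sigma> (Suc k) < T" for k
    using \<omega> that by (auto simp: short_gap_def short_gap_at_def \<sigma>_def simp del: drop_time.simps)
  have t0: "t 0 = 0" using T by (simp add: t_def \<sigma>_def)
  have t_Suc: "t i + \<delta> \<le> t (Suc i)" for i
  proof (cases "\<sigma> (Suc i) < T")
    case True
    then show ?thesis using mono[of i] gap[OF True] by (simp add: t_def)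
  next
    case False
    moreover have "0 \<le> real i * \<delta>" using \<delta> by simp
    ultimately show ?thesis by (simp add: t_def algebra_simps)
  qed
  have t_le: "t i \<le> T + real i * \<delta>" for i using \<delta> by (simp add: t_def add_increasing2)
  have osc: "q s \<omega> \<le> q r \<omega> + \<epsilon>" if "r \<in> {t i..<t (Suc i)}" "s \<in> {t i..<t (Suc i)}" "r < T" "s < T" for i r s
  proof -
    have "0 \<le> real i * \<delta>" using \<delta> by simp
    then have \<sigma>i: "\<sigma> i < T" "t i = \<sigma> i" using that(1,3) by (auto simp: t_def split: if_splits)
    have "\<not> \<sigma> (Suc i) \<le> r" using that by (auto simp: t_def split: if_splits)
    then have "q (\<sigma> i) \<omega> - \<epsilon> < q r \<omega>"
      using drop_time_Suc_le_iff[OF \<epsilon> T \<omega>(1), of r i] that bounds(1)[of i] \<sigma>i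
      by (auto simp: \<sigma>_def simp del: drop_time.simps)
    moreover have "q s \<omega> \<le> q (\<sigma> i) \<omega>"
      using that \<sigma>i bounds(1)[of i] by (intro decreasing[OF \<omega>(1)]) auto
    ultimately show ?thesis by simp
  qed
  have "\<bar>q r \<omega> - q s \<omega>\<bar> \<le> \<epsilon>"
    if "r \<in> {t i..<t (Suc i)}" "s \<in> {t i..<t (Suc i)}" "r < T" "s < T" for i r s
    using osc[OF that] osc[OF that(2,1,4,3)] by (simp add: abs_le_iff)
  then show ?thesis using t0 t_Suc t_le by (intro that[of t]) auto
qed

end

text \<open>The hypothesis on increments speaks of sequences, and a subsequence argument turns it into a bound
  on single gaps that is uniform in \<open>k\<close> and in all late \<open>n\<close>.  A first delay \<open>\<delta>1\<close> bounds the number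
  \<open>N\<close> of drops, independently of the size of the processes; a second delay \<open>\<delta>2\<close> then makes a short
  gap among \<open>N\<close> of them unlikely.  The finitely many early processes are covered one by one.\<close>

lemma short_gaps_uniformly_rare:
  fixes M :: "nat \<Rightarrow> 'a measure" and F :: "nat \<Rightarrow> real \<Rightarrow> 'a measure" and q :: "nat \<Rightarrow> real \<Rightarrow> 'a \<Rightarrow> real"
  assumes dp: "\<And>n. decreasing_process (M n) (F n) (q n)"
    and increments: "\<And>\<tau> h. \<lbrakk>\<And>n. stopping_time (F n) (\<tau> n);
       \<And>n \<omega>. \<omega> \<in> space (M n) \<Longrightarrow> 0 \<le> \<tau> n \<omega>; \<exists>C. \<forall>n. \<forall>\<omega>\<in>space (M n). \<tau> n \<omega> \<le> C;
       \<And>n. 0 < h n; h \<longlonglongrightarrow> 0\<rbrakk>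
      \<Longrightarrow> tendsto_0_in_probability M (\<lambda>n \<omega>. q n (\<tau> n \<omega>) \<omega> - q n (\<tau> n \<omega> + h n) \<omega>)"
    and \<epsilon>: "0 < \<epsilon>" and T: "0 < T" and \<eta>: "0 < \<eta>"
  shows "\<exists>\<delta>>0. \<forall>n. measure (M n) (decreasing_process.short_gap (M n) (q n) \<epsilon> T \<delta>) \<le> \<eta>"
proof -
  define G where "G n = decreasing_process.short_gap_at (M n) (q n) \<epsilon> T" for n
  define \<sigma> where "\<sigma> n = decreasing_process.drop_time (q n) \<epsilon> T" for n
  have \<sigma>_bounds: "0 \<le> \<sigma> n k \<omega>" "\<sigma> n k \<omega> \<le> T" for n k \<omega>
    unfolding \<sigma>_def using decreasing_process.drop_time_bounds[OF dp \<epsilon> T] by auto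
  have eventually_rare: "\<exists>\<delta>>0. \<exists>n0. \<forall>n\<ge>n0. \<forall>k. measure (M n) (G n \<delta> k) \<le> \<theta>" if "0 < \<theta>" for \<theta>
  proof (rule ccontr)
    assume neg: "\<not> ?thesis"
    define bad where "bad n m \<longleftrightarrow> (\<exists>k. \<theta> < measure (M n) (G n (1 / Suc m) k))" for n m
    have ex: "\<exists>n\<ge>n0. bad n m" for n0 m
    proof -
      have "\<not> (\<forall>n\<ge>n0. \<forall>k. measure (M n) (G n (1 / Suc m) k) \<le> \<theta>)"
        using neg by (meson of_nat_0_less_iff zero_less_Suc zero_less_divide_1_iff)
      then show ?thesis unfolding bad_def by (meson not_le)
    qed
    have "\<exists>r. \<forall>m. bad (r m) m \<and> r m < r (Suc m)"
      by (rule dependent_nat_choice) (use ex Suc_le_lessD in blast)+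
    then obtain r where r_bad: "\<And>m. bad (r m) m" and "\<And>m. r m < r (Suc m)" by blast
    then have r: "strict_mono r" by (simp add: strict_mono_Suc_iff)
    then have inv_r: "inv r (r m) = m" for m by (simp add: strict_mono_imp_inj_on)
    obtain \<kappa> where \<kappa>: "\<And>m. \<theta> < measure (M (r m)) (G (r m) (1 / Suc m) (\<kappa> m))"
      using r_bad unfolding bad_def by metis
    \<comment> \<open>Offending stopping times and delays along the subsequence \<open>r\<close>, harmless ones elsewhere.\<close>
    define \<tau> where "\<tau> n = (if n \<in> range r then \<sigma> n (\<kappa> (inv r n)) else (\<lambda>_. 0))" for n
    define h :: "nat \<Rightarrow> real" where "h n = 1 / Suc (if n \<in> range r then inv r n else n)" for n
    have "h \<longlonglongrightarrow> 0"
    proof (rule LIMSEQ_I)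
      fix e :: real assume "0 < e"
      then obtain m where m: "1 / Suc m < e" by (rule nat_approx_posE)
      have "norm (h n - 0) < e" if n: "max m (r m) \<le> n" for n
      proof -
        have "m \<le> (if n \<in> range r then inv r n else n)"
          using n strict_mono_less_eq[OF r] by (auto simp: inv_r)
        then have "h n \<le> 1 / Suc m" unfolding h_def by (intro divide_left_mono) auto
        moreover have "0 \<le> h n" by (simp add: h_def)
        ultimately show ?thesis using m by simp
      qed
      then show "\<exists>n0. \<forall>n\<ge>n0. norm (h n - 0) < e" by blast
    qed
    moreover have "stopping_time (F n) (\<tau> n)" for n
      unfolding \<tau>_def \<sigma>_def using decreasing_process.stopping_time_drop_time[OF dp \<epsilon> T]
      by (simp add: stopping_time_const)
    moreover have \<tau>_bounds: "0 \<le> \<tau> n \<omega>" "\<tau> n \<omega> \<le> T" for n \<omega>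
      using \<sigma>_bounds T by (auto simp: \<tau>_def)
    moreover have "0 < h n" for n by (simp add: h_def)
    ultimately have "tendsto_0_in_probability M (\<lambda>n \<omega>. q n (\<tau> n \<omega>) \<omega> - q n (\<tau> n \<omega> + h n) \<omega>)"
      by (intro increments) blast+
    then have "(\<lambda>n. measure (M n) {\<omega> \<in> space (M n).
        \<bar>q n (\<tau> n \<omega>) \<omega> - q n (\<tau> n \<omega> + h n) \<omega>\<bar> > \<epsilon> / 2}) \<longlonglongrightarrow> 0" (is "?p \<longlonglongrightarrow> 0")
      using \<epsilon> unfolding tendsto_0_in_probability_def by (elim allE[of _ "\<epsilon> / 2"]) simp
    then have "\<forall>\<^sub>F n in sequentially. ?p n < \<theta>" using \<open>0 < \<theta>\<close> by (rule order_tendstoD(2))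
    then have "\<forall>\<^sub>F m in sequentially. ?p (r m) < \<theta>" using r by (rule eventually_subseq[rotated])
    then obtain m where m: "?p (r m) < \<theta>" by (auto dest: eventually_happens)
    interpret decreasing_process "M (r m)" "F (r m)" "q (r m)" by (rule dp)
    have \<tau>_eq: "\<tau> (r m) = drop_time \<epsilon> T (\<kappa> m)" and h_eq: "h (r m) = 1 / Suc m"
      by (simp_all add: \<tau>_def h_def inv_r \<sigma>_def)
    have [measurable]: "\<tau> (r m) \<in> borel_measurable (M (r m))"
      unfolding \<tau>_eq by (rule drop_time_measurable[OF \<epsilon> T])
    have q_meas: "q (r m) s \<in> borel_measurable (M (r m))" if "0 \<le> s" for s
      by (rule measurable_from_subalg[OF _ adapted[OF that]])
        (simp add: subalgebra_def space_F sets_F_M)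
    have [measurable]: "(\<lambda>\<omega>. q (r m) (\<tau> (r m) \<omega>) \<omega>) \<in> borel_measurable (M (r m))"
      by (rule right_continuous_random_time_measurable[OF _ _ q_meas right_cont])
        (use \<tau>_bounds in auto)
    have [measurable]: "(\<lambda>\<omega>. q (r m) (\<tau> (r m) \<omega> + 1 / Suc m) \<omega>) \<in> borel_measurable (M (r m))"
      by (rule right_continuous_random_time_measurable[OF _ _ q_meas right_cont, where c = "T + 1 / Suc m"])
        (use \<tau>_bounds in auto)
    have "G (r m) (1 / Suc m) (\<kappa> m) \<subseteq> {\<omega> \<in> space (M (r m)).
        \<bar>q (r m) (\<tau> (r m) \<omega>) \<omega> - q (r m) (\<tau> (r m) \<omega> + 1 / Suc m) \<omega>\<bar> > \<epsilon> / 2}"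
      using short_gap_at_subset[OF \<epsilon> T, of "1 / Suc m" "\<kappa> m"] \<epsilon> unfolding G_def \<tau>_eq by force
    then have "measure (M (r m)) (G (r m) (1 / Suc m) (\<kappa> m)) \<le> ?p (r m)"
      unfolding h_eq by (intro finite_measure_mono) measurable
    then show False using m \<kappa>[of m] by simp
  qed
  obtain \<delta>1 n1 where \<delta>1: "0 < \<delta>1" "\<And>n k. n1 \<le> n \<Longrightarrow> measure (M n) (G n \<delta>1 k) \<le> \<eta> / 4"
    using eventually_rare[of "\<eta> / 4"] \<eta> by auto
  obtain N where "2 * T < real N * \<delta>1" using reals_Archimedean3[OF \<delta>1(1)] by blast
  then have N: "2 * T \<le> real N * \<delta>1" by simp
  obtain \<delta>2 n2 where \<delta>2: "0 < \<delta>2" "\<And>n k. n2 \<le> n \<Longrightarrow> measure (M n) (G n \<delta>2 k) \<le> \<eta> / (2 * Suc N)"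
    using eventually_rare[of "\<eta> / (2 * Suc N)"] \<eta> by auto
  have late: "measure (M n) (decreasing_process.short_gap (M n) (q n) \<epsilon> T \<delta>2) \<le> \<eta>"
    if n: "max n1 n2 \<le> n" for n
  proof -
    interpret decreasing_process "M n" "F n" "q n" by (rule dp)
    have "prob (short_gap \<epsilon> T \<delta>2) \<le>
        prob {\<omega> \<in> space (M n). drop_time \<epsilon> T N \<omega> < T} + (\<Sum>k<N. prob (short_gap_at \<epsilon> T \<delta>2 k))"
      by (rule prob_short_gap_le[OF \<epsilon> T])
    also have "prob {\<omega> \<in> space (M n). drop_time \<epsilon> T N \<omega> < T} \<le> 2 * (\<eta> / 4)"
      using \<delta>1 N n by (intro prob_many_drops_le[OF \<epsilon> T, of \<delta>1]) (auto simp: G_def)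
    also have "(\<Sum>k<N. prob (short_gap_at \<epsilon> T \<delta>2 k)) \<le> (\<Sum>k<N. \<eta> / (2 * Suc N))"
      using \<delta>2(2) n by (intro sum_mono) (simp add: G_def)
    also have "\<dots> \<le> \<eta> / 2" using \<eta> by (simp add: field_simps)
    finally show ?thesis by simp
  qed
  have "\<exists>\<delta>>0. measure (M n) (decreasing_process.short_gap (M n) (q n) \<epsilon> T \<delta>) \<le> \<eta>" for n
    by (rule decreasing_process.prob_short_gap_small[OF dp \<epsilon> T \<eta>])
  then obtain d where d: "\<And>n. 0 < d n"
    "\<And>n. measure (M n) (decreasing_process.short_gap (M n) (q n) \<epsilon> T (d n)) \<le> \<eta>"
    by metis
  define \<delta> where "\<delta> = Min (insert \<delta>2 (d ` {..max n1 n2}))"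
  have "0 < \<delta>" unfolding \<delta>_def using \<delta>2(1) d(1) by (subst Min_gr_iff) auto
  moreover have "measure (M n) (decreasing_process.short_gap (M n) (q n) \<epsilon> T \<delta>) \<le> \<eta>" for n
  proof -
    interpret decreasing_process "M n" "F n" "q n" by (rule dp)
    obtain \<delta>' where \<delta>': "\<delta> \<le> \<delta>'" "prob (short_gap \<epsilon> T \<delta>') \<le> \<eta>"
    proof (cases "n \<le> max n1 n2")
      case True
      then have "\<delta> \<le> d n" unfolding \<delta>_def by (intro Min_le) auto
      then show ?thesis using that d(2) by blast
    next
      case False
      then have "max n1 n2 \<le> n" by linarith
      moreover have "\<delta> \<le> \<delta>2" unfolding \<delta>_def by (intro Min_le) auto
      ultimately show ?thesis using that late by blast
    qed
    have "prob (short_gap \<epsilon> T \<delta>) \<le> prob (short_gap \<epsilon> T \<delta>')"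
      using \<delta>'(1) by (intro finite_measure_mono short_gap_mono[OF \<epsilon> T] short_gap_measurable[OF \<epsilon> T])
    then show ?thesis using \<delta>'(2) by simp
  qed
  ultimately show ?thesis by blast
qed

section \<open>Measurability of being nearly a step function\<close>

lemma nearly_step_cong:
  assumes "0 < \<delta>" "\<And>s. 0 \<le> s \<Longrightarrow> x s = y s"
  shows "nearly_step T \<delta> \<epsilon> x \<longleftrightarrow> nearly_step T \<delta> \<epsilon> y"
proof -
  have "osc_le T \<epsilon> UNIV t x \<longleftrightarrow> osc_le T \<epsilon> UNIV t y" if t: "t \<in> sparse_partitions T \<delta>" for t
  proof -
    have "0 \<le> t i" for i
      using sparse_partition_mono[OF t assms(1), of 0 i] sparse_partition_0[OF t assms(1)] by simp
    then have "x r = y r" if "r \<in> UNIV \<inter> {t i..<t (Suc i)}" for r i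
      using that by (intro assms(2)) (auto intro: order_trans)
    then show ?thesis unfolding osc_le_def by (auto simp del: Int_iff)
  qed
  then show ?thesis unfolding nearly_step_def by blast
qed

text \<open>Covers the index \<open>j = 0\<close> of the compact set, where the horizon is degenerate.\<close>

lemma nearly_step_horizon_0: "0 < \<delta> \<Longrightarrow> nearly_step 0 \<delta> \<epsilon> x"
  unfolding nearly_step_def
proof (rule bexI)
  show "osc_le 0 \<epsilon> UNIV (\<lambda>i. real i * \<delta>) x" if "0 < \<delta>"
    using that unfolding osc_le_def by (auto simp: mult_less_0_iff dest!: order.strict_trans1)
  show "(\<lambda>i. real i * \<delta>) \<in> sparse_partitions 0 \<delta>"
    by (simp add: sparse_partitions_def algebra_simps)
qed

text \<open>A partition enters the condition on a finite set \<open>F\<close> of times only through the pairs of points of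
  \<open>F\<close> that it puts into one piece.  There are finitely many such patterns, although there are
  uncountably many partitions.\<close>

lemma nearly_step_measurable:
  fixes X :: "real \<Rightarrow> 'a \<Rightarrow> 'b::{metric_space, second_countable_topology}"
  assumes \<delta>: "0 < \<delta>" and X: "\<And>s. 0 \<le> s \<Longrightarrow> X s \<in> borel_measurable M"
    and rc: "\<And>\<omega> s. \<omega> \<in> space M \<Longrightarrow> 0 \<le> s \<Longrightarrow> ((\<lambda>s. X s \<omega>) \<longlongrightarrow> X s \<omega>) (at_right s)"
  shows "{\<omega> \<in> space M. nearly_step T \<delta> \<epsilon> (\<lambda>s. X s \<omega>)} \<in> sets M"
proof -
  define \<F> where "\<F> = {F. finite F \<and> F \<subseteq> \<rat> \<inter> {0::real..}}"
  have "countable \<F>"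
    unfolding \<F>_def by (intro countable_Collect_finite_subset) (simp add: countable_rat)
  have "{} \<in> \<F>" by (simp add: \<F>_def)
  have fixed: "{\<omega> \<in> space M. \<exists>t\<in>sparse_partitions T \<delta>. osc_le T \<epsilon> F t (\<lambda>s. X s \<omega>)} \<in> sets M"
    if F: "F \<in> \<F>" for F
  proof -
    define pairs where "pairs t = {p \<in> F \<times> F. \<exists>i. fst p \<in> {t i..<t (Suc i)} \<and>
      snd p \<in> {t i..<t (Suc i)} \<and> fst p < T \<and> snd p < T}" for t :: "nat \<Rightarrow> real"
    have fin: "finite F" and nonneg: "\<And>r. r \<in> F \<Longrightarrow> 0 \<le> r" using F by (auto simp: \<F>_def)
    have "pairs ` sparse_partitions T \<delta> \<subseteq> Pow (F \<times> F)" by (auto simp: pairs_def)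
    then have fin': "finite (pairs ` sparse_partitions T \<delta>)"
      by (rule finite_subset) (simp add: fin)
    have osc: "osc_le T \<epsilon> F t x \<longleftrightarrow> (\<forall>p\<in>pairs t. dist (x (fst p)) (x (snd p)) \<le> \<epsilon>)" for t and x :: "real \<Rightarrow> 'b"
      unfolding osc_le_def pairs_def by force
    have "{\<omega> \<in> space M. \<exists>t\<in>sparse_partitions T \<delta>. osc_le T \<epsilon> F t (\<lambda>s. X s \<omega>)} =
        {\<omega> \<in> space M. \<exists>R\<in>pairs ` sparse_partitions T \<delta>.
          \<forall>p\<in>R. dist (X (fst p) \<omega>) (X (snd p) \<omega>) \<le> \<epsilon>}"
      unfolding osc by auto
    also have "\<dots> \<in> sets M"
    proof (intro sets.sets_Collect_finite_Ex sets.sets_Collect_finite_All)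
      fix R p assume R: "R \<in> pairs ` sparse_partitions T \<delta>" "p \<in> R"
      then have p: "0 \<le> fst p" "0 \<le> snd p" using nonneg by (auto simp: pairs_def)
      have [measurable]: "X (fst p) \<in> borel_measurable M" "X (snd p) \<in> borel_measurable M"
        using X p by auto
      show "{\<omega> \<in> space M. dist (X (fst p) \<omega>) (X (snd p) \<omega>) \<le> \<epsilon>} \<in> sets M" by measurable
    next
      fix R assume "R \<in> pairs ` sparse_partitions T \<delta>"
      then have "R \<subseteq> F \<times> F" by (auto simp: pairs_def)
      then show "finite R" by (rule finite_subset) (simp add: fin)
    qed (rule fin')
    finally show ?thesis .
  qed
  have "{\<omega> \<in> space M. nearly_step T \<delta> \<epsilon> (\<lambda>s. X s \<omega>)} =
      (\<Inter>F\<in>\<F>. {\<omega> \<in> space M. \<exists>t\<in>sparse_partitions T \<delta>. osc_le T \<epsilon> F t (\<lambda>s. X s \<omega>)})"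
  proof (intro set_eqI iffI)
    fix \<omega> assume "\<omega> \<in> {\<omega> \<in> space M. nearly_step T \<delta> \<epsilon> (\<lambda>s. X s \<omega>)}"
    then show "\<omega> \<in> (\<Inter>F\<in>\<F>. {\<omega> \<in> space M. \<exists>t\<in>sparse_partitions T \<delta>. osc_le T \<epsilon> F t (\<lambda>s. X s \<omega>)})"
      using nearly_step_iff_rational[OF \<delta> rc, of \<omega> T \<epsilon>] by (auto simp: \<F>_def)
  next
    fix \<omega> assume *: "\<omega> \<in> (\<Inter>F\<in>\<F>. {\<omega> \<in> space M. \<exists>t\<in>sparse_partitions T \<delta>. osc_le T \<epsilon> F t (\<lambda>s. X s \<omega>)})"
    then have "\<omega> \<in> space M" using \<open>{} \<in> \<F>\<close> by blast
    then show "\<omega> \<in> {\<omega> \<in> space M. nearly_step T \<delta> \<epsilon> (\<lambda>s. X s \<omega>)}"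
      using nearly_step_iff_rational[OF \<delta> rc, of \<omega> T \<epsilon>] * by (auto simp: \<F>_def)
  qed
  also have "\<dots> \<in> sets M"
    using \<open>countable \<F>\<close> \<open>{} \<in> \<F>\<close> fixed by (intro sets.countable_INT') auto
  finally show ?thesis .
qed

section \<open>Fragmentation processes\<close>

lemma Q_borel_measurable [measurable]: "Q \<in> borel_measurable borel"
  unfolding Q_def by measurable

lemma fragmentation_path_S_down: "fragmentation_path x \<Longrightarrow> 0 \<le> t \<Longrightarrow> x t \<in> S_down"
  by (simp add: fragmentation_path_def cadlag_def)

lemma fragmentation_path_right_cont:
  "fragmentation_path x \<Longrightarrow> 0 \<le> t \<Longrightarrow> (x \<longlongrightarrow> x t) (at_right t)"
  by (simp add: fragmentation_path_def cadlag_def)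

lemma fragmentation_path_le: "fragmentation_path x \<Longrightarrow> 0 \<le> s \<Longrightarrow> s \<le> t \<Longrightarrow> x t \<preceq> x s"
  by (simp add: fragmentation_path_def)

lemma fragmentation_path_Q_decreasing:
  assumes "fragmentation_path x" "0 \<le> s" "s \<le> t"
  shows "Q (x t) \<le> Q (x s)"
  using assms by (intro Q_mono fragmentation_path_le fragmentation_path_S_down) auto

lemma fragmentation_path_Q_finite:
  assumes "fragmentation_path x" "Q (x 0) < \<infinity>" "0 \<le> t"
  shows "Q (x t) < \<infinity>"
  using fragmentation_path_Q_decreasing[OF assms(1) _ assms(3)] assms(2) by (auto intro: order_le_less_trans)

text \<open>\<open>Q\<close> is not continuous for the product topology, but as a supremum of finite sums it is lower
  semicontinuous.  This gives one half; the other half is monotonicity.\<close>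

lemma fragmentation_path_Q_right_cont:
  assumes x: "fragmentation_path x" and fin: "Q (x 0) < \<infinity>" and t: "0 \<le> t"
  shows "((\<lambda>s. enn2real (Q (x s))) \<longlongrightarrow> enn2real (Q (x t))) (at_right t)"
proof (rule order_tendstoI)
  note Q_fin = fragmentation_path_Q_finite[OF x fin]
  have ev: "\<forall>\<^sub>F s in at_right t. t < s" by (simp add: eventually_at_right_less)
  fix a assume a: "a < enn2real (Q (x t))"
  have sums: "enn2real (Q (x s)) = (\<Sum>i. (x s i)\<^sup>2)" "summable (\<lambda>i. (x s i)\<^sup>2)" if "0 \<le> s" for s
    using Q_eq_suminf[OF Q_fin[OF that]] by (simp_all add: suminf_nonneg)
  have "(\<lambda>N. \<Sum>i<N. (x t i)\<^sup>2) \<longlonglongrightarrow> (\<Sum>i. (x t i)\<^sup>2)"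
    using sums(2)[OF t] by (rule summable_LIMSEQ)
  from eventually_happens'[OF sequentially_bot order_tendstoD(1)[OF this a[unfolded sums(1)[OF t]]]]
  obtain N where N: "a < (\<Sum>i<N. (x t i)\<^sup>2)" ..
  have "((\<lambda>s. \<Sum>i<N. (x s i)\<^sup>2) \<longlongrightarrow> (\<Sum>i<N. (x t i)\<^sup>2)) (at_right t)"
    by (intro tendsto_sum tendsto_power tendsto_coordinate[OF fragmentation_path_right_cont[OF x t]])
  from order_tendstoD(1)[OF this N] ev show "\<forall>\<^sub>F s in at_right t. a < enn2real (Q (x s))"
  proof eventually_elim
    case (elim s)
    then have "(\<Sum>i<N. (x s i)\<^sup>2) \<le> enn2real (Q (x s))"
      using t sums[of s] by (simp add: sum_le_suminf)
    then show ?case using elim by simp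
  qed
next
  fix a assume a: "enn2real (Q (x t)) < a"
  have "\<forall>\<^sub>F s in at_right t. t < s" by (simp add: eventually_at_right_less)
  then show "\<forall>\<^sub>F s in at_right t. enn2real (Q (x s)) < a"
  proof eventually_elim
    case (elim s)
    then have "Q (x s) \<le> Q (x t)" using t by (intro fragmentation_path_Q_decreasing[OF x]) auto
    then have "enn2real (Q (x s)) \<le> enn2real (Q (x t))"
      using fragmentation_path_Q_finite[OF x fin t] by (simp add: enn2real_mono)
    then show ?case using a by simp
  qed
qed

lemma space_natural_filtration: "space (natural_filtration M X t) = space M"
  by (simp add: natural_filtration_def space_measure_of_conv)

lemma sets_natural_filtration:
  "sets (natural_filtration M X t) =
     sigma_sets (space M) {X s -` A \<inter> space M | s A. 0 \<le> s \<and> s \<le> t \<and> A \<in> sets borel}"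
  unfolding natural_filtration_def by (rule sets_measure_of) auto

lemma filtration_natural: "filtration (space M) (natural_filtration M X)"
proof
  show "sets (natural_filtration M X s) \<le> sets (natural_filtration M X t)" if "s \<le> t" for s t
    unfolding sets_natural_filtration using that by (intro sigma_sets_mono') force
qed (rule space_natural_filtration)

lemma natural_filtration_adapted:
  "0 \<le> s \<Longrightarrow> s \<le> t \<Longrightarrow> X s \<in> borel_measurable (natural_filtration M X t)"
  by (rule measurableI)
    (auto simp: sets_natural_filtration space_natural_filtration intro!: sigma_sets.Basic)

lemma sets_natural_filtration_subset:
  assumes "\<And>s. 0 \<le> s \<Longrightarrow> X s \<in> borel_measurable M"
  shows "sets (natural_filtration M X t) \<subseteq> sets M"
  unfolding sets_natural_filtration using assms
  by (intro sets.sigma_sets_subset) (auto intro: measurable_sets)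

text \<open>The value \<open>0\<close> on the null event \<open>Q (X 0) = \<infinity>\<close> makes every path decreasing.  Without it,
  \<^const>\<open>enn2real\<close> would let a path jump up from \<open>0\<close> at the moment when \<open>Q\<close> becomes finite.\<close>

definition Q_path :: "(real \<Rightarrow> 'a \<Rightarrow> nat \<Rightarrow> real) \<Rightarrow> real \<Rightarrow> 'a \<Rightarrow> real" where
  "Q_path X t \<omega> = (if Q (X 0 \<omega>) < \<infinity> then enn2real (Q (X t \<omega>)) else 0)"

lemma decreasing_process_Q_path:
  assumes M: "prob_space M" and X: "fragmentation_process M X"
  shows "decreasing_process M (natural_filtration M X) (Q_path X)"
proof -
  interpret prob_space M by fact
  interpret filtration "space M" "natural_filtration M X" by (rule filtration_natural)
  have path: "fragmentation_path (\<lambda>t. X t \<omega>)" if "\<omega> \<in> space M" for \<omega>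
    using X that by (simp add: fragmentation_process_def)
  show ?thesis
  proof
    show "sets (natural_filtration M X t) \<subseteq> sets M" for t
      using X by (intro sets_natural_filtration_subset) (simp add: fragmentation_process_def)
    show "Q_path X t \<in> borel_measurable (natural_filtration M X t)" if "0 \<le> t" for t
    proof -
      have [measurable]: "X 0 \<in> borel_measurable (natural_filtration M X t)"
        "X t \<in> borel_measurable (natural_filtration M X t)"
        using that by (auto intro: natural_filtration_adapted)
      show ?thesis unfolding Q_path_def by measurable
    qed
    fix \<omega> t assume \<omega>: "\<omega> \<in> space M" and t: "0 \<le> (t::real)"
    show "((\<lambda>s. Q_path X s \<omega>) \<longlongrightarrow> Q_path X t \<omega>) (at_right t)"
      using fragmentation_path_Q_right_cont[OF path[OF \<omega>] _ t] by (auto simp: Q_path_def)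
    show "0 \<le> Q_path X t \<omega>" by (simp add: Q_path_def)
  next
    fix \<omega> s t assume \<omega>: "\<omega> \<in> space M" and s: "0 \<le> (s::real)" "s \<le> t"
    show "Q_path X t \<omega> \<le> Q_path X s \<omega>"
      using fragmentation_path_Q_decreasing[OF path[OF \<omega>] s]
        fragmentation_path_Q_finite[OF path[OF \<omega>] _ s(1)]
      by (auto simp: Q_path_def intro: enn2real_mono)
  qed
qed

lemma compact_S_down_bounded: "compact {x \<in> S_down. x 0 \<le> c}"
proof -
  have c: "continuous_on UNIV (\<lambda>x::nat \<Rightarrow> real. x i)" for i
    by (rule continuous_on_product_coordinates)
  have "{x \<in> S_down. x 0 \<le> c} = {x. (\<forall>i. x (Suc i) \<le> x i \<and> 0 \<le> x i) \<and> x 0 \<le> c}"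
    by (simp add: S_down_def decseq_Suc_iff all_conj_distrib)
  moreover have "closed {x::nat \<Rightarrow> real. (\<forall>i. x (Suc i) \<le> x i \<and> 0 \<le> x i) \<and> x 0 \<le> c}"
    by (intro closed_Collect_conj closed_Collect_all closed_Collect_le continuous_intros c)
  moreover have "compact {x::nat \<Rightarrow> real. \<forall>i. x i \<in> {0..c}}"
    by (rule compact_functions) simp
  moreover have "{x \<in> S_down. x 0 \<le> c} \<subseteq> {x. \<forall>i. x i \<in> {0..c}}"
  proof
    fix x assume "x \<in> {x \<in> S_down. x 0 \<le> c}"
    then have x: "x \<in> S_down" "x 0 \<le> c" by auto
    have "0 \<le> x i \<and> x i \<le> c" for i
      using S_down_antimono[OF x(1), of 0 i] S_down_nonneg[OF x(1), of i] x(2) by simp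
    then show "x \<in> {x. \<forall>i. x i \<in> {0..c}}" by simp
  qed
  ultimately show ?thesis
    using compact_Int_closed[of "{x::nat \<Rightarrow> real. \<forall>i. x i \<in> {0..c}}" "{x \<in> S_down. x 0 \<le> c}"]
    by (simp add: Int_absorb1)
qed

lemma sample_path_skorohod:
  assumes "fragmentation_path (\<lambda>t. X t \<omega>)"
  shows "sample_path X \<omega> \<in> skorohod_space S_down"
proof -
  have x: "cadlag S_down (\<lambda>t. X t \<omega>)" using assms by (simp add: fragmentation_path_def)
  have "cadlag S_down (sample_path X \<omega>)"
    unfolding cadlag_def
  proof (intro conjI allI impI)
    fix t :: real assume t: "0 \<le> t"
    show "sample_path X \<omega> t \<in> S_down" using x t by (simp add: cadlag_def sample_path_def)
    have "\<forall>\<^sub>F s in at_right t. sample_path X \<omega> s = X s \<omega>"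
      using eventually_at_right_less[of t] by eventually_elim (use t in \<open>simp add: sample_path_def\<close>)
    moreover have "((\<lambda>s. X s \<omega>) \<longlongrightarrow> sample_path X \<omega> t) (at_right t)"
      using x t by (simp add: cadlag_def sample_path_def)
    ultimately show "(sample_path X \<omega> \<longlongrightarrow> sample_path X \<omega> t) (at_right t)"
      by (simp add: tendsto_cong)
  next
    fix t :: real assume t: "0 < t"
    then obtain l where l: "l \<in> S_down" "((\<lambda>s. X s \<omega>) \<longlongrightarrow> l) (at_left t)"
      using x unfolding cadlag_def by blast
    have "\<forall>\<^sub>F s in at_left t. 0 < s" using t eventually_at_left_field by blast
    then have "\<forall>\<^sub>F s in at_left t. sample_path X \<omega> s = X s \<omega>"
      by eventually_elim (simp add: sample_path_def)
    then show "\<exists>l\<in>S_down. (sample_path X \<omega> \<longlongrightarrow> l) (at_left t)"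
      using l by (auto simp: tendsto_cong)
  qed
  then show ?thesis by (simp add: skorohod_space_def sample_path_def)
qed

text \<open>The threshold is the square of \<open>\<epsilon> / 2\<close> because the distance is at most twice the square root of
  the drop.\<close>

lemma nearly_step_of_no_short_gap:
  assumes M: "prob_space M" and X: "fragmentation_process M X"
    and \<delta>: "0 < \<delta>" and T: "0 < T" and \<epsilon>: "0 < \<epsilon>"
    and \<omega>: "\<omega> \<in> space M" "Q (X 0 \<omega>) < \<infinity>"
    and gap: "\<omega> \<notin> decreasing_process.short_gap M (Q_path X) ((\<epsilon> / 2)\<^sup>2) T \<delta>"
  shows "nearly_step T \<delta> \<epsilon> (\<lambda>t. X t \<omega>)"
proof -
  interpret decreasing_process M "natural_filtration M X" "Q_path X"
    using M X by (rule decreasing_process_Q_path)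
  have path: "fragmentation_path (\<lambda>t. X t \<omega>)" using X \<omega> by (simp add: fragmentation_process_def)
  obtain t where t: "t 0 = 0" "\<And>i. t i + \<delta> \<le> t (Suc i)" "\<And>i. t i \<le> T + real i * \<delta>"
    and osc: "\<And>i r s. r \<in> {t i..<t (Suc i)} \<Longrightarrow> s \<in> {t i..<t (Suc i)} \<Longrightarrow> r < T \<Longrightarrow> s < T \<Longrightarrow>
      \<bar>Q_path X r \<omega> - Q_path X s \<omega>\<bar> \<le> (\<epsilon> / 2)\<^sup>2"
    by (rule short_gap_free_path[OF _ T \<delta> \<omega>(1) gap]) (use \<epsilon> in auto)
  have part: "t \<in> sparse_partitions T \<delta>" using t by (simp add: sparse_partitions_def)
  have close: "dist (X s \<omega>) (X r \<omega>) \<le> \<epsilon>"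
    if "r \<in> {t i..<t (Suc i)}" "s \<in> {t i..<t (Suc i)}" "r < T" "s < T" "r \<le> s" for i r s
  proof -
    have r: "0 \<le> r"
      using that(1) sparse_partition_mono[OF part \<delta>, of 0 i] t(1) by simp
    then have s: "0 \<le> s" using that(5) by simp
    have "enn2real (Q (X r \<omega>)) - enn2real (Q (X s \<omega>)) \<le> (\<epsilon> / 2)\<^sup>2"
      using osc[OF that(1-4)] \<omega>(2) by (simp add: Q_path_def)
    then have "sqrt (enn2real (Q (X r \<omega>)) - enn2real (Q (X s \<omega>))) \<le> \<epsilon> / 2"
      using \<epsilon> by (intro real_le_lsqrt) auto
    moreover have "dist (X s \<omega>) (X r \<omega>) \<le> 2 * sqrt (enn2real (Q (X r \<omega>)) - enn2real (Q (X s \<omega>)))"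
      using r s by (intro dist_le_sqrt_Q_drop fragmentation_path_le[OF path r that(5)]
          fragmentation_path_S_down[OF path] fragmentation_path_Q_finite[OF path \<omega>(2)])
    ultimately show ?thesis by simp
  qed
  have "osc_le T \<epsilon> UNIV t (\<lambda>t. X t \<omega>)"
    unfolding osc_le_def
  proof (intro allI ballI impI)
    fix i r s assume "r \<in> UNIV \<inter> {t i..<t (Suc i)}" "s \<in> UNIV \<inter> {t i..<t (Suc i)}" "r < T" "s < T"
    then show "dist (X r \<omega>) (X s \<omega>) \<le> \<epsilon>"
      using close[of s i r] close[of r i s] by (cases "r \<le> s") (auto simp: dist_commute)
  qed
  then show ?thesis using part unfolding nearly_step_def by blast
qed

text \<open>The two sequences of increments agree almost surely.  Both must be shown measurable, since
  \<^const>\<open>measure\<close> has the value \<open>0\<close> on non-measurable sets.\<close>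

lemma Q_path_increments_vanish:
  fixes M :: "nat \<Rightarrow> 'a measure" and X :: "nat \<Rightarrow> real \<Rightarrow> 'a \<Rightarrow> nat \<Rightarrow> real"
  assumes prob: "\<And>n. prob_space (M n)"
    and frag: "\<And>n. fragmentation_process (M n) (X n)"
    and Q_finite: "\<And>n. AE \<omega> in M n. Q (X n 0 \<omega>) < \<infinity>"
    and \<tau>: "\<And>n. \<tau> n \<in> borel_measurable (M n)"
      "\<And>n \<omega>. \<omega> \<in> space (M n) \<Longrightarrow> 0 \<le> \<tau> n \<omega>" "\<And>n \<omega>. \<omega> \<in> space (M n) \<Longrightarrow> \<tau> n \<omega> \<le> C"
    and h: "\<And>n. 0 < h n"
    and lim: "tendsto_0_in_probability M
      (\<lambda>n \<omega>. enn2real (Q (X n (\<tau> n \<omega>) \<omega>)) - enn2real (Q (X n (\<tau> n \<omega> + h n) \<omega>)))"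
  shows "tendsto_0_in_probability M
      (\<lambda>n \<omega>. Q_path (X n) (\<tau> n \<omega>) \<omega> - Q_path (X n) (\<tau> n \<omega> + h n) \<omega>)"
proof -
  have "measure (M n) {\<omega> \<in> space (M n). \<bar>Q_path (X n) (\<tau> n \<omega>) \<omega> - Q_path (X n) (\<tau> n \<omega> + h n) \<omega>\<bar> > e} =
    measure (M n) {\<omega> \<in> space (M n).
      \<bar>enn2real (Q (X n (\<tau> n \<omega>) \<omega>)) - enn2real (Q (X n (\<tau> n \<omega> + h n) \<omega>))\<bar> > e}" for n e
  proof -
    interpret prob_space "M n" by (rule prob)
    have X_meas: "X n s \<in> borel_measurable (M n)" if "0 \<le> s" for s
      using frag[of n] that by (simp add: fragmentation_process_def)
    have rc: "((\<lambda>s. X n s \<omega>) \<longlongrightarrow> X n s \<omega>) (at_right s)" if "\<omega> \<in> space (M n)" "0 \<le> s" for s \<omega>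
      using frag[of n] that
      by (intro fragmentation_path_right_cont[where x = "\<lambda>s. X n s \<omega>"]) (auto simp: fragmentation_process_def)
    have [measurable]: "X n 0 \<in> borel_measurable (M n)" by (rule X_meas) simp
    have [measurable]: "\<tau> n \<in> borel_measurable (M n)" by (rule \<tau>)
    have [measurable]: "(\<lambda>\<omega>. X n (\<tau> n \<omega>) \<omega>) \<in> borel_measurable (M n)"
      by (rule right_continuous_random_time_measurable[OF _ _ X_meas rc, where c = C])
        (use \<tau> in auto)
    have [measurable]: "(\<lambda>\<omega>. X n (\<tau> n \<omega> + h n) \<omega>) \<in> borel_measurable (M n)"
      by (rule right_continuous_random_time_measurable[OF _ _ X_meas rc, where c = "C + h n"])
        (use \<tau> h[of n] in \<open>auto intro: add_nonneg_nonneg\<close>)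
    show ?thesis
    proof (rule measure_eq_AE)
      show "AE \<omega> in M n.
        \<omega> \<in> {\<omega> \<in> space (M n). \<bar>Q_path (X n) (\<tau> n \<omega>) \<omega> - Q_path (X n) (\<tau> n \<omega> + h n) \<omega>\<bar> > e} \<longleftrightarrow>
        \<omega> \<in> {\<omega> \<in> space (M n).
          \<bar>enn2real (Q (X n (\<tau> n \<omega>) \<omega>)) - enn2real (Q (X n (\<tau> n \<omega> + h n) \<omega>))\<bar> > e}"
        using Q_finite[of n] by eventually_elim (simp add: Q_path_def)
    qed (unfold Q_path_def, measurable)
  qed
  then show ?thesis using lim unfolding tendsto_0_in_probability_def by simp
qed

lemma uniformly_nearly_step:
  fixes M :: "nat \<Rightarrow> 'a measure" and X :: "nat \<Rightarrow> real \<Rightarrow> 'a \<Rightarrow> nat \<Rightarrow> real"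
  assumes prob: "\<And>n. prob_space (M n)"
    and frag: "\<And>n. fragmentation_process (M n) (X n)"
    and Q_finite: "\<And>n. AE \<omega> in M n. Q (X n 0 \<omega>) < \<infinity>"
    and Q_increments: "\<And>\<tau> h.
      \<lbrakk>\<And>n. process_stopping_time (M n) (X n) (\<tau> n);
       \<exists>C. \<forall>n. \<forall>\<omega>\<in>space (M n). \<tau> n \<omega> \<le> C;
       \<And>n. h n > 0;
       h \<longlonglongrightarrow> 0\<rbrakk>
      \<Longrightarrow> tendsto_0_in_probability M
            (\<lambda>n \<omega>. enn2real (Q (X n (\<tau> n \<omega>) \<omega>)) - enn2real (Q (X n (\<tau> n \<omega> + h n) \<omega>)))"
    and T: "0 < T" and \<epsilon>: "0 < \<epsilon>" and \<eta>: "0 < \<eta>"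
  shows "\<exists>\<delta>>0. \<forall>n. measure (M n) {\<omega> \<in> space (M n). \<not> nearly_step T \<delta> \<epsilon> (\<lambda>t. X n t \<omega>)} \<le> \<eta>"
proof -
  have dp: "decreasing_process (M n) (natural_filtration (M n) (X n)) (Q_path (X n))" for n
    using prob frag by (rule decreasing_process_Q_path)
  have "\<exists>\<delta>>0. \<forall>n. measure (M n)
      (decreasing_process.short_gap (M n) (Q_path (X n)) ((\<epsilon> / 2)\<^sup>2) T \<delta>) \<le> \<eta>"
  proof (rule short_gaps_uniformly_rare[OF dp])
    fix \<tau> :: "nat \<Rightarrow> 'a \<Rightarrow> real" and h :: "nat \<Rightarrow> real"
    assume st: "\<And>n. stopping_time (natural_filtration (M n) (X n)) (\<tau> n)"
      and nonneg: "\<And>n \<omega>. \<omega> \<in> space (M n) \<Longrightarrow> 0 \<le> \<tau> n \<omega>"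
      and bdd: "\<exists>C. \<forall>n. \<forall>\<omega>\<in>space (M n). \<tau> n \<omega> \<le> C"
      and h: "\<And>n. 0 < h n" "h \<longlonglongrightarrow> 0"
    obtain C where C: "\<And>n \<omega>. \<omega> \<in> space (M n) \<Longrightarrow> \<tau> n \<omega> \<le> C" using bdd by blast
    have "process_stopping_time (M n) (X n) (\<tau> n)" for n
      using st nonneg by (simp add: process_stopping_time_def)
    then have lim: "tendsto_0_in_probability M
        (\<lambda>n \<omega>. enn2real (Q (X n (\<tau> n \<omega>) \<omega>)) - enn2real (Q (X n (\<tau> n \<omega> + h n) \<omega>)))"
      using bdd h by (rule Q_increments)
    have "\<tau> n \<in> borel_measurable (M n)" for n
      by (rule measurable_stopping_time[OF st decreasing_process.sets_F_M[OF dp] space_natural_filtration])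
    then show "tendsto_0_in_probability M
        (\<lambda>n \<omega>. Q_path (X n) (\<tau> n \<omega>) \<omega> - Q_path (X n) (\<tau> n \<omega> + h n) \<omega>)"
      by (rule Q_path_increments_vanish[OF prob frag Q_finite _ nonneg C h(1) lim])
  qed (use T \<epsilon> \<eta> in auto)
  then obtain \<delta> where \<delta>: "0 < \<delta>" "\<And>n. measure (M n)
      (decreasing_process.short_gap (M n) (Q_path (X n)) ((\<epsilon> / 2)\<^sup>2) T \<delta>) \<le> \<eta>"
    by blast
  have "measure (M n) {\<omega> \<in> space (M n). \<not> nearly_step T \<delta> \<epsilon> (\<lambda>t. X n t \<omega>)} \<le> \<eta>" for n
  proof -
    interpret decreasing_process "M n" "natural_filtration (M n) (X n)" "Q_path (X n)" by (rule dp)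
    have "0 < (\<epsilon> / 2)\<^sup>2" using \<epsilon> by simp
    note short_gap_measurable[OF this T, of \<delta>, measurable]
    have "prob {\<omega> \<in> space (M n). \<not> nearly_step T \<delta> \<epsilon> (\<lambda>t. X n t \<omega>)} \<le> prob (short_gap ((\<epsilon> / 2)\<^sup>2) T \<delta>)"
    proof (rule finite_measure_mono_AE)
      show "AE \<omega> in M n. \<omega> \<in> {\<omega> \<in> space (M n). \<not> nearly_step T \<delta> \<epsilon> (\<lambda>t. X n t \<omega>)} \<longrightarrow>
          \<omega> \<in> short_gap ((\<epsilon> / 2)\<^sup>2) T \<delta>"
        using Q_finite[of n]
        by eventually_elim (use nearly_step_of_no_short_gap[OF prob frag \<delta>(1) T \<epsilon>, of _ n] in blast)
    qed measurable
    then show ?thesis using \<delta>(2)[of n] by simp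
  qed
  then show ?thesis using \<delta>(1) by blast
qed

theorem theorem3p1:
  fixes M :: "nat \<Rightarrow> 'a measure"
    and X :: "nat \<Rightarrow> real \<Rightarrow> 'a \<Rightarrow> nat \<Rightarrow> real"
  assumes prob: "\<And>n. prob_space (M n)"
    and frag: "\<And>n. fragmentation_process (M n) (X n)"
    and Q_finite: "\<And>n. AE \<omega> in M n. Q (X n 0 \<omega>) < \<infinity>"
    and tight_marginals: "\<And>t. t \<ge> 0 \<Longrightarrow> tight_family (top_of_set S_down) M (\<lambda>n. X n t)"
    and Q_increments: "\<And>\<tau> h.
      \<lbrakk>\<And>n. process_stopping_time (M n) (X n) (\<tau> n);
       \<exists>C. \<forall>n. \<forall>\<omega>\<in>space (M n). \<tau> n \<omega> \<le> C;
       \<And>n. h n > 0;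
       h \<longlonglongrightarrow> 0\<rbrakk>
      \<Longrightarrow> tendsto_0_in_probability M
            (\<lambda>n \<omega>. enn2real (Q (X n (\<tau> n \<omega>) \<omega>)) - enn2real (Q (X n (\<tau> n \<omega> + h n) \<omega>)))"
  shows "tight_family (skorohod_J1 S_down) M (\<lambda>n. sample_path (X n))"
  unfolding tight_family_def
proof (intro allI impI)
  fix \<epsilon> :: real assume \<epsilon>: "0 < \<epsilon>"
  have "tight_family (top_of_set S_down) M (\<lambda>n. X n 0)" by (rule tight_marginals) simp
  then have "\<exists>K. compactin (top_of_set S_down) K \<and>
      (\<forall>n. {\<omega> \<in> space (M n). X n 0 \<omega> \<in> K} \<in> sets (M n) \<and>
        1 - \<epsilon> / 2 \<le> measure (M n) {\<omega> \<in> space (M n). X n 0 \<omega> \<in> K})"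
    unfolding tight_family_def using \<epsilon> by (elim allE[of _ "\<epsilon> / 2"]) simp
  then obtain K0 where "compactin (top_of_set S_down) K0 \<and>
      (\<forall>n. {\<omega> \<in> space (M n). X n 0 \<omega> \<in> K0} \<in> sets (M n) \<and>
        1 - \<epsilon> / 2 \<le> measure (M n) {\<omega> \<in> space (M n). X n 0 \<omega> \<in> K0})" ..
  then have K0: "compactin (top_of_set S_down) K0"
    "1 - \<epsilon> / 2 \<le> measure (M n) {\<omega> \<in> space (M n). X n 0 \<omega> \<in> K0}" for n
    by simp_all
  have "compact K0" using K0(1) by (simp add: compactin_subtopology)
  then have "compact ((\<lambda>x. x 0) ` K0)"
    by (rule compact_continuous_image[OF
          continuous_on_subset[OF continuous_on_product_coordinates subset_UNIV]])
  then have "bdd_above ((\<lambda>x. x 0) ` K0)" by (intro bounded_imp_bdd_above compact_imp_bounded)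
  then obtain c where c: "\<And>x. x \<in> K0 \<Longrightarrow> x 0 \<le> c" unfolding bdd_above_def by blast
  have "\<exists>\<delta>>0. \<forall>n. measure (M n)
      {\<omega> \<in> space (M n). \<not> nearly_step (real j) \<delta> (1 / Suc j) (\<lambda>t. X n t \<omega>)} \<le> \<epsilon> / 4 * (1 / 2) ^ j" for j
  proof (cases "j = 0")
    case True
    then show ?thesis using \<epsilon> by (intro exI[of _ 1]) (simp add: nearly_step_horizon_0)
  next
    case False
    then show ?thesis
      using \<epsilon> by (intro uniformly_nearly_step prob frag Q_finite Q_increments) auto
  qed
  from choice[OF allI[OF this]]
  obtain \<delta> where "\<forall>j. 0 < \<delta> j \<and> (\<forall>n. measure (M n)
      {\<omega> \<in> space (M n). \<not> nearly_step (real j) (\<delta> j) (1 / Suc j) (\<lambda>t. X n t \<omega>)} \<le> \<epsilon> / 4 * (1 / 2) ^ j)" ..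
  then have \<delta>: "0 < \<delta> j" "measure (M n)
      {\<omega> \<in> space (M n). \<not> nearly_step (real j) (\<delta> j) (1 / Suc j) (\<lambda>t. X n t \<omega>)} \<le> \<epsilon> / 4 * (1 / 2) ^ j" for j n
    by simp_all
  define K where "K = {x \<in> skorohod_space S_down. (\<forall>s\<ge>0. x s \<in> {x \<in> S_down. x 0 \<le> c}) \<and>
    (\<forall>j. nearly_step (real j) (\<delta> j) (1 / Suc j) x)}"
  have "compactin (skorohod_J1 S_down) K"
    unfolding K_def by (intro compactin_skorohod_J1_nearly_step compact_S_down_bounded \<delta>(1)) auto
  moreover have "{\<omega> \<in> space (M n). sample_path (X n) \<omega> \<in> K} \<in> sets (M n) \<and>
      1 - \<epsilon> \<le> measure (M n) {\<omega> \<in> space (M n). sample_path (X n) \<omega> \<in> K}" for n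
  proof -
    interpret prob_space "M n" by (rule prob)
    have path: "fragmentation_path (\<lambda>t. X n t \<omega>)" if "\<omega> \<in> space (M n)" for \<omega>
      using frag[of n] that by (simp add: fragmentation_process_def)
    have X_meas: "X n s \<in> borel_measurable (M n)" if "0 \<le> s" for s
      using frag[of n] that by (simp add: fragmentation_process_def)
    have [measurable]: "(\<lambda>\<omega>. X n 0 \<omega> 0) \<in> borel_measurable (M n)"
      by (rule measurable_product_then_coordinatewise[OF X_meas]) simp
    define A where "A = {\<omega> \<in> space (M n). X n 0 \<omega> 0 \<le> c}"
    define B where "B j = {\<omega> \<in> space (M n). \<not> nearly_step (real j) (\<delta> j) (1 / Suc j) (\<lambda>t. X n t \<omega>)}" for j
    have A[measurable]: "A \<in> events" unfolding A_def by measurable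
    have B[measurable]: "B j \<in> events" for j
    proof -
      have "{\<omega> \<in> space (M n). nearly_step (real j) (\<delta> j) (1 / Suc j) (\<lambda>t. X n t \<omega>)} \<in> events"
        by (intro nearly_step_measurable \<delta>(1) X_meas fragmentation_path_right_cont[OF path])
      then show ?thesis unfolding B_def by measurable
    qed
    have sample: "nearly_step (real j) (\<delta> j) e (sample_path (X n) \<omega>) \<longleftrightarrow>
        nearly_step (real j) (\<delta> j) e (\<lambda>t. X n t \<omega>)" for j e \<omega>
      by (intro nearly_step_cong \<delta>(1)) (simp add: sample_path_def)
    have confined: "X n s \<omega> \<in> {x \<in> S_down. x 0 \<le> c}" if "\<omega> \<in> A" "0 \<le> s" for \<omega> s
    proof -
      have p: "fragmentation_path (\<lambda>t. X n t \<omega>)" using that by (intro path) (simp add: A_def)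
      have "X n s \<omega> 0 \<le> X n 0 \<omega> 0"
        by (rule frag_le_first[OF fragmentation_path_le[OF p order_refl that(2)]
              fragmentation_path_S_down[OF p order_refl] fragmentation_path_S_down[OF p that(2)]])
      then show ?thesis using that fragmentation_path_S_down[OF p that(2)] by (simp add: A_def)
    qed
    have "sample_path (X n) \<omega> \<in> K \<longleftrightarrow> \<omega> \<in> A - (\<Union>j. B j)" if \<omega>: "\<omega> \<in> space (M n)" for \<omega>
    proof
      assume K: "sample_path (X n) \<omega> \<in> K"
      then have "sample_path (X n) \<omega> 0 \<in> {x \<in> S_down. x 0 \<le> c}" by (simp add: K_def)
      moreover have "nearly_step (real j) (\<delta> j) (1 / Suc j) (\<lambda>t. X n t \<omega>)" for j
        using K unfolding K_def sample[symmetric] by simp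
      ultimately show "\<omega> \<in> A - (\<Union>j. B j)"
        using \<omega> by (simp add: A_def B_def sample_path_def)
    next
      assume AB: "\<omega> \<in> A - (\<Union>j. B j)"
      have "sample_path (X n) \<omega> \<in> skorohod_space S_down"
        by (rule sample_path_skorohod) (rule path[OF \<omega>])
      moreover have "sample_path (X n) \<omega> s \<in> {x \<in> S_down. x 0 \<le> c}" if "0 \<le> s" for s
        using confined[of \<omega> s] AB that by (simp add: sample_path_def)
      moreover have "nearly_step (real j) (\<delta> j) (1 / Suc j) (sample_path (X n) \<omega>)" for j
        using AB \<omega> unfolding sample B_def by simp
      ultimately show "sample_path (X n) \<omega> \<in> K" by (simp add: K_def)
    qed
    then have event: "{\<omega> \<in> space (M n). sample_path (X n) \<omega> \<in> K} = A - (\<Union>j. B j)"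
      by (auto simp: A_def)
    have "prob (space (M n) - A) \<le> \<epsilon> / 2"
    proof -
      have "prob {\<omega> \<in> space (M n). X n 0 \<omega> \<in> K0} \<le> prob A"
        using c by (intro finite_measure_mono A) (auto simp: A_def)
      then show ?thesis using K0(2)[of n] prob_compl[OF A] by simp
    qed
    moreover have "prob (\<Union>j. B j) \<le> \<epsilon> / 2"
    proof -
      have "(\<lambda>j. \<epsilon> / 4 * (1 / 2) ^ j) sums (\<epsilon> / 4 * 2)"
        using geometric_sums[of "1 / 2 :: real"] by (intro sums_mult) simp
      then have half: "(\<lambda>j. \<epsilon> / 4 * (1 / 2) ^ j) sums (\<epsilon> / 2)" by simp
      have "ennreal (prob (\<Union>j. B j)) = emeasure (M n) (\<Union>j. B j)" by (simp add: emeasure_eq_measure)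
      also have "\<dots> \<le> (\<Sum>j. emeasure (M n) (B j))" by (intro emeasure_subadditive_countably) auto
      also have "\<dots> \<le> (\<Sum>j. ennreal (\<epsilon> / 4 * (1 / 2) ^ j))"
        using \<delta>(2)[of n] by (intro suminf_le) (auto simp: emeasure_eq_measure B_def intro!: ennreal_leI)
      also have "\<dots> = ennreal (\<epsilon> / 2)"
        using half \<epsilon> by (subst suminf_ennreal2) (auto simp: sums_iff)
      finally show ?thesis using \<epsilon> by simp
    qed
    moreover have "1 \<le> prob (A - (\<Union>j. B j)) + (prob (space (M n) - A) + prob (\<Union>j. B j))"
    proof -
      have "1 = prob ((A - (\<Union>j. B j)) \<union> ((space (M n) - A) \<union> (\<Union>j. B j)))"
        using sets.sets_into_space[OF A] sets.sets_into_space[OF B]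
        by (subst prob_space[symmetric]) (auto intro!: arg_cong[of _ _ prob])
      also have "\<dots> \<le> prob (A - (\<Union>j. B j)) + prob ((space (M n) - A) \<union> (\<Union>j. B j))"
        by (intro measure_Un_le) auto
      also have "prob ((space (M n) - A) \<union> (\<Union>j. B j)) \<le> prob (space (M n) - A) + prob (\<Union>j. B j)"
        by (intro measure_Un_le) auto
      finally show ?thesis by simp
    qed
    ultimately have "1 - \<epsilon> \<le> prob (A - (\<Union>j. B j))" by simp
    then show ?thesis unfolding event by auto
  qed
  ultimately show "\<exists>K. compactin (skorohod_J1 S_down) K \<and>
      (\<forall>n. {\<omega> \<in> space (M n). sample_path (X n) \<omega> \<in> K} \<in> sets (M n) \<and>
        1 - \<epsilon> \<le> measure (M n) {\<omega> \<in> space (M n). sample_path (X n) \<omega> \<in> K})"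
    by blast
qed

end
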